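(* The category $\mathbf{WPC}$ of weak parity complexes is equivalent to the category of weak Steiner complexes (the full subcategory of the category $\mathbf{ADC}$ of augmented directed complexes on the weak Steiner complexes).
   Context: **Multisets.** $\mathcal{M}_f(B)$ is the set of finite multisets of a set $B$, i.e. functions $B\to\mathbb{N}$ of finite support; $\sqcup$ is pointwise addition; $(S\setminus T)(b)=\max(S(b)-T(b),0)$. Finite subsets are identified with multisets of multiplicity at most one. $\mathcal{P}_f(B)$ is the set of finite subsets of $B$. **Weak parity complexes.** A parity structure is a graded set $C=(C_n)_{n\ge 0}$ together with, for each $n\ge0$ and $x\in C_{n+1}$, a disjoint pair of finite subsets $x^-,x^+\subseteq C_n$. For $n>0$ and $S\subseteq C_n$ put $S^-=\bigcup_{x\in S}x^-$, $S^+=\bigcup_{x\in S}x^+$, $S^\mp=S^-\setminus S^+$, $S^\pm=S^+\setminus S^-$. A subset $S\subseteq C_n$ is well-formed if (i) $n=0$ and $S$ is a singleton, or (ii) $n>0$ and for all $x\ne y$ in $S$, $x^-\cap y^-=x^+\cap y^+=\emptyset$. For $x\in C_n$ define $\mu(x)_n=\pi(x)_n=\{x\}$, $\mu(x)_{k-1}=\mu(x)_k^\mp$, $\pi(x)_{k-1}=\pi(x)_k^\pm$ for $1\le k\le n$. A weak parity complex is a parity structure $C$ which is - globular: for all $n\ge2$, $x\in C_n$: $(x^-)^\mp=(x^+)^\mp$ and $(x^-)^\pm=(x^+)^\pm$; - unital: for all $n\ge 0$, $x\in C_n$, $0\le k\le n$, the subsets $\mu(x)_k,\pi(x)_k$ are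 well-formed; - weakly loop-free: for each $n\ge1$ there is a partial order $\triangleleft$ on $C_n$ such that $x\triangleleft y$ whenever $x^+\cap y^-\neq\emptyset$. **Morphisms.** For a finite multiset $S$ of $C_{n+1}$ let $\Phi^\pm(S)=\bigsqcup_{x\in S}x^\pm$ (with multiplicity), $\partial^-(S)=\Phi^-(S)\setminus\Phi^+(S)$, $\partial^+(S)=\Phi^+(S)\setminus\Phi^-(S)$. $S$ moves $M$ to $P$ (finite multisets of $C_n$) if $\partial^-(S)=M\setminus P$ and $\partial^+(S)=P\setminus M$. A morphism of weak parity complexes $f\colon C\to D$ is a family of functions $f_n\colon C_n\to\mathcal{P}_f(D_n)$ ($n\ge0$) such that for each $x\in C_n$ the subset $f_n(x)$ is well-formed and, if $n>0$, $f_n(x)$ moves $\bigcup_{y\in x^-}f_{n-1}(y)$ to $\bigcup_{y\in x^+}f_{n-1}(y)$. Composition is $(g\circ f)_n(x)=\bigcup_{y\in f_n(x)}g_n(y)$, and identities are $x\mapsto\{x\}$. This defines $\mathbf{WPC}$. **Augmented directed complexes.** A preordered abelian group is an abelian group $A$ with a preorder such that $a\le b$ implies $a+c\le b+c$; $A^*=\{a\in A: a\ge0\}$. A basis of $A$ is a subset $B\subseteq A^*$ which is a basis of both the commutative monoid $A^*$ and the abelian group $A$ (unique if it exists). Then $A\cong\mathbb{Z}B$ (finitely supported functions $B\to\mathbb{Z}$, pointwise order) is lattice-ordered, and each $x\in A$ is uniquely $x=x_+-x_-$ with $x_\pm\in A^*$, $x_+\wedge x_-=0$ (positive and negative parts).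 A directed chain complex is a chain complex $K$ of abelian groups in degrees $\ge0$ with each $K_n$ a preordered abelian group (boundary maps not assumed monotone); morphisms are chain maps that are monotone in each degree. An augmented directed complex is a directed chain complex $K$ with a monotone homomorphism $\varepsilon\colon K_0\to\mathbb{Z}$ (natural order on $\mathbb{Z}$) with $\varepsilon\partial=0$; morphisms are augmentation-preserving morphisms of directed chain complexes. A basis of $K$ is a family $B=(B_n)$ with $B_n$ a basis of $K_n$. For $x\in K_{n+1}$, $\partial^-x,\partial^+x$ are the negative and positive parts of $\partial x$. The basis is unital if $\varepsilon((\partial^-)^nx)=\varepsilon((\partial^+)^nx)=1$ for all $n\ge 0$, $x\in B_n$. It is weakly loop-free if for each $n\ge1$ there is a partial order $\triangleleft$ on $B_n$ such that $x\triangleleft y$ whenever $\partial^+x\wedge\partial^-y\ne0$. A weak Steiner complex is an augmented directed complex with a weakly loop-free unital basis. *)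

theory Defs
  imports "HOL-Algebra.Free_Abelian_Groups" "HOL-Library.Multiset"
begin

section \<open>Categories and equivalences\<close>

text \<open>An arrow is not assumed to determine its source and target, so composition
  \<open>cmp C X Y Z g f\<close> and the arrow map of a functor carry the objects as arguments.\<close>

record ('o, 'm) category =
  obj :: "'o set"
  arr :: "'o \<Rightarrow> 'o \<Rightarrow> 'm set"
  cmp :: "'o \<Rightarrow> 'o \<Rightarrow> 'o \<Rightarrow> 'm \<Rightarrow> 'm \<Rightarrow> 'm"
  idn :: "'o \<Rightarrow> 'm"

definition is_category :: "('o, 'm) category \<Rightarrow> bool" where
  "is_category C \<longleftrightarrow>
     (\<forall>X \<in> obj C. idn C X \<in> arr C X X) \<and>
     (\<forall>X \<in> obj C. \<forall>Y \<in> obj C. \<forall>Z \<in> obj C. \<forall>f \<in> arr C X Y. \<forall>g \<in> arr C Y Z.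
        cmp C X Y Z g f \<in> arr C X Z) \<and>
     (\<forall>X \<in> obj C. \<forall>Y \<in> obj C. \<forall>f \<in> arr C X Y.
        cmp C X X Y f (idn C X) = f \<and> cmp C X Y Y (idn C Y) f = f) \<and>
     (\<forall>W \<in> obj C. \<forall>X \<in> obj C. \<forall>Y \<in> obj C. \<forall>Z \<in> obj C.
      \<forall>f \<in> arr C W X. \<forall>g \<in> arr C X Y. \<forall>h \<in> arr C Y Z.
        cmp C W Y Z h (cmp C W X Y g f) = cmp C W X Z (cmp C X Y Z h g) f)"

definition full_subcategory :: "('o, 'm) category \<Rightarrow> ('o \<Rightarrow> bool) \<Rightarrow> ('o, 'm) category" where
  "full_subcategory C P = C\<lparr>obj := {X \<in> obj C. P X}\<rparr>"

definition isomorphism :: "('o, 'm) category \<Rightarrow> 'o \<Rightarrow> 'o \<Rightarrow> 'm \<Rightarrow> bool" where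
  "isomorphism C X Y f \<longleftrightarrow> f \<in> arr C X Y \<and>
     (\<exists>g \<in> arr C Y X. cmp C X Y X g f = idn C X \<and> cmp C Y X Y f g = idn C Y)"

record ('o, 'm, 'p, 'n) cat_functor =
  fob :: "'o \<Rightarrow> 'p"
  far :: "'o \<Rightarrow> 'o \<Rightarrow> 'm \<Rightarrow> 'n"

definition is_functor ::
  "('o, 'm) category \<Rightarrow> ('p, 'n) category \<Rightarrow> ('o, 'm, 'p, 'n) cat_functor \<Rightarrow> bool" where
  "is_functor C D F \<longleftrightarrow>
     (\<forall>X \<in> obj C. fob F X \<in> obj D) \<and>
     (\<forall>X \<in> obj C. \<forall>Y \<in> obj C. \<forall>f \<in> arr C X Y.
        far F X Y f \<in> arr D (fob F X) (fob F Y)) \<and>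
     (\<forall>X \<in> obj C. far F X X (idn C X) = idn D (fob F X)) \<and>
     (\<forall>X \<in> obj C. \<forall>Y \<in> obj C. \<forall>Z \<in> obj C. \<forall>f \<in> arr C X Y. \<forall>g \<in> arr C Y Z.
        far F X Z (cmp C X Y Z g f) =
        cmp D (fob F X) (fob F Y) (fob F Z) (far F Y Z g) (far F X Y f))"

definition id_functor :: "('o, 'm, 'o, 'm) cat_functor" where
  "id_functor = \<lparr>fob = (\<lambda>X. X), far = (\<lambda>X Y f. f)\<rparr>"

definition comp_functor ::
  "('p, 'n, 'q, 'l) cat_functor \<Rightarrow> ('o, 'm, 'p, 'n) cat_functor \<Rightarrow> ('o, 'm, 'q, 'l) cat_functor"
  where
  "comp_functor G F = \<lparr>fob = (\<lambda>X. fob G (fob F X)),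
     far = (\<lambda>X Y f. far G (fob F X) (fob F Y) (far F X Y f))\<rparr>"

definition natural_isomorphism ::
  "('o, 'm) category \<Rightarrow> ('p, 'n) category \<Rightarrow> ('o, 'm, 'p, 'n) cat_functor \<Rightarrow>
   ('o, 'm, 'p, 'n) cat_functor \<Rightarrow> ('o \<Rightarrow> 'n) \<Rightarrow> bool" where
  "natural_isomorphism C D F G \<eta> \<longleftrightarrow>
     (\<forall>X \<in> obj C. isomorphism D (fob F X) (fob G X) (\<eta> X)) \<and>
     (\<forall>X \<in> obj C. \<forall>Y \<in> obj C. \<forall>f \<in> arr C X Y.
        cmp D (fob F X) (fob F Y) (fob G Y) (\<eta> Y) (far F X Y f) =
        cmp D (fob F X) (fob G X) (fob G Y) (far G X Y f) (\<eta> X))"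

definition equivalent_categories :: "('o, 'm) category \<Rightarrow> ('p, 'n) category \<Rightarrow> bool" where
  "equivalent_categories C D \<longleftrightarrow> is_category C \<and> is_category D \<and>
     (\<exists>F G \<eta> \<epsilon>. is_functor C D F \<and> is_functor D C G \<and>
        natural_isomorphism C C id_functor (comp_functor G F) \<eta> \<and>
        natural_isomorphism D D (comp_functor F G) id_functor \<epsilon>)"


section \<open>Weak parity complexes\<close>

text \<open>Boundaries are indexed by the dimension they land in: for \<open>x \<in> cells C (Suc n)\<close> the sets
  \<open>x\<^sup>-\<close> and \<open>x\<^sup>+\<close> are \<open>neg C n x\<close> and \<open>pos C n x\<close>, subsets of \<open>cells C n\<close>.
  The index is needed since the sets \<open>cells C n\<close> may overlap for different \<open>n\<close>.\<close>

record 'u parity =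
  cells :: "nat \<Rightarrow> 'u set"
  neg :: "nat \<Rightarrow> 'u \<Rightarrow> 'u set"
  pos :: "nat \<Rightarrow> 'u \<Rightarrow> 'u set"

definition parity_structure :: "'u parity \<Rightarrow> bool" where
  "parity_structure C \<longleftrightarrow> (\<forall>n. \<forall>x \<in> cells C (Suc n).
     neg C n x \<in> Fpow (cells C n) \<and> pos C n x \<in> Fpow (cells C n) \<and>
     neg C n x \<inter> pos C n x = {})"

definition negs :: "'u parity \<Rightarrow> nat \<Rightarrow> 'u set \<Rightarrow> 'u set" where
  "negs C n S = (\<Union>x\<in>S. neg C n x)"

definition poss :: "'u parity \<Rightarrow> nat \<Rightarrow> 'u set \<Rightarrow> 'u set" where
  "poss C n S = (\<Union>x\<in>S. pos C n x)"

text \<open>For \<open>S \<subseteq> cells C (Suc n)\<close> these are \<open>S\<^sup>-\<close> minus \<open>S\<^sup>+\<close> and \<open>S\<^sup>+\<close> minus \<open>S\<^sup>-\<close>.\<close>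

definition mp :: "'u parity \<Rightarrow> nat \<Rightarrow> 'u set \<Rightarrow> 'u set" where
  "mp C n S = negs C n S - poss C n S"

definition pm :: "'u parity \<Rightarrow> nat \<Rightarrow> 'u set \<Rightarrow> 'u set" where
  "pm C n S = poss C n S - negs C n S"

fun well_formed :: "'u parity \<Rightarrow> nat \<Rightarrow> 'u set \<Rightarrow> bool" where
  "well_formed C 0 S \<longleftrightarrow> S \<subseteq> cells C 0 \<and> is_singleton S"
| "well_formed C (Suc n) S \<longleftrightarrow> S \<subseteq> cells C (Suc n) \<and>
     (\<forall>x\<in>S. \<forall>y\<in>S. x \<noteq> y \<longrightarrow>
        neg C n x \<inter> neg C n y = {} \<and> pos C n x \<inter> pos C n y = {})"

text \<open>For \<open>x \<in> cells C n\<close> and \<open>k \<le> n\<close>, \<open>mu C n x k\<close> and \<open>pi_sets C n x k\<close> are the subsets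
  \<open>\<mu>(x)\<^sub>k\<close> and \<open>\<pi>(x)\<^sub>k\<close> of \<open>cells C k\<close>.\<close>

function mu :: "'u parity \<Rightarrow> nat \<Rightarrow> 'u \<Rightarrow> nat \<Rightarrow> 'u set" where
  "mu C n x k = (if k < n then mp C k (mu C n x (Suc k)) else {x})"
  by pat_completeness auto
termination by (relation "measure (\<lambda>(C, n, x, k). n - k)") auto

function pi_sets :: "'u parity \<Rightarrow> nat \<Rightarrow> 'u \<Rightarrow> nat \<Rightarrow> 'u set" where
  "pi_sets C n x k = (if k < n then pm C k (pi_sets C n x (Suc k)) else {x})"
  by pat_completeness auto
termination by (relation "measure (\<lambda>(C, n, x, k). n - k)") auto

declare mu.simps [simp del] pi_sets.simps [simp del]

definition globular :: "'u parity \<Rightarrow> bool" where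
  "globular C \<longleftrightarrow> (\<forall>n. \<forall>x \<in> cells C (Suc (Suc n)).
     mp C n (neg C (Suc n) x) = mp C n (pos C (Suc n) x) \<and>
     pm C n (neg C (Suc n) x) = pm C n (pos C (Suc n) x))"

definition unital :: "'u parity \<Rightarrow> bool" where
  "unital C \<longleftrightarrow> (\<forall>n. \<forall>x \<in> cells C n. \<forall>k\<le>n.
     well_formed C k (mu C n x k) \<and> well_formed C k (pi_sets C n x k))"

definition weakly_loop_free :: "'u parity \<Rightarrow> bool" where
  "weakly_loop_free C \<longleftrightarrow> (\<forall>n. \<exists>r. partial_order_on (cells C (Suc n)) r \<and>
     (\<forall>x \<in> cells C (Suc n). \<forall>y \<in> cells C (Suc n).
        pos C n x \<inter> neg C n y \<noteq> {} \<longrightarrow> (x, y) \<in> r))"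

definition weak_parity_complex :: "'u parity \<Rightarrow> bool" where
  "weak_parity_complex C \<longleftrightarrow>
     parity_structure C \<and> globular C \<and> unital C \<and> weakly_loop_free C"

definition Phi_neg :: "'u parity \<Rightarrow> nat \<Rightarrow> 'u multiset \<Rightarrow> 'u multiset" where
  "Phi_neg C n S = (\<Sum>x\<in>#S. mset_set (neg C n x))"

definition Phi_pos :: "'u parity \<Rightarrow> nat \<Rightarrow> 'u multiset \<Rightarrow> 'u multiset" where
  "Phi_pos C n S = (\<Sum>x\<in>#S. mset_set (pos C n x))"

definition moves :: "'u parity \<Rightarrow> nat \<Rightarrow> 'u multiset \<Rightarrow> 'u multiset \<Rightarrow> 'u multiset \<Rightarrow> bool" where
  "moves C n S M P \<longleftrightarrow>
     Phi_neg C n S - Phi_pos C n S = M - P \<and> Phi_pos C n S - Phi_neg C n S = P - M"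

definition wpc_hom :: "'u parity \<Rightarrow> 'u parity \<Rightarrow> (nat \<Rightarrow> 'u \<Rightarrow> 'u set) set" where
  "wpc_hom C D = {f.
     (\<forall>n. f n \<in> cells C n \<rightarrow>\<^sub>E Fpow (cells D n)) \<and>
     (\<forall>n. \<forall>x \<in> cells C n. well_formed D n (f n x)) \<and>
     (\<forall>n. \<forall>x \<in> cells C (Suc n).
        moves D n (mset_set (f (Suc n) x))
          (mset_set (\<Union>y \<in> neg C n x. f n y)) (mset_set (\<Union>y \<in> pos C n x. f n y)))}"

definition WPC :: "('u parity, nat \<Rightarrow> 'u \<Rightarrow> 'u set) category" where
  "WPC = \<lparr>obj = {C. weak_parity_complex C},
     arr = wpc_hom,
     cmp = (\<lambda>C D E g f n. \<lambda>x \<in> cells C n. \<Union>y \<in> f n x. g n y),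
     idn = (\<lambda>C n. \<lambda>x \<in> cells C n. {x})\<rparr>"


section \<open>Augmented directed complexes\<close>

text \<open>Abelian groups are commutative groups in the sense of \<open>HOL-Algebra\<close>, hence written
  multiplicatively: \<open>\<otimes>\<close>, \<open>\<one>\<close>, \<open>inv\<close> and \<open>[^]\<close> stand for addition, zero, negation and
  multiples. The preorder is a relation on the carrier, \<open>(a, b) \<in> leq A\<close> meaning \<open>a \<le> b\<close>.\<close>

record 'u pgroup = "'u monoid" +
  leq :: "'u rel"

definition preordered_abelian_group :: "'u pgroup \<Rightarrow> bool" where
  "preordered_abelian_group A \<longleftrightarrow> comm_group A \<and> preorder_on (carrier A) (leq A) \<and>
     (\<forall>a \<in> carrier A. \<forall>b \<in> carrier A. \<forall>c \<in> carrier A.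
        (a, b) \<in> leq A \<longrightarrow> (a \<otimes>\<^bsub>A\<^esub> c, b \<otimes>\<^bsub>A\<^esub> c) \<in> leq A)"

definition cone :: "'u pgroup \<Rightarrow> 'u set" where
  "cone A = {a \<in> carrier A. (\<one>\<^bsub>A\<^esub>, a) \<in> leq A}"

definition nat_lincomb :: "'u pgroup \<Rightarrow> ('u \<Rightarrow>\<^sub>0 nat) \<Rightarrow> 'u" where
  "nat_lincomb A c = finprod A (\<lambda>b. b [^]\<^bsub>A\<^esub> Poly_Mapping.lookup c b) (Poly_Mapping.keys c)"

definition int_lincomb :: "'u pgroup \<Rightarrow> ('u \<Rightarrow>\<^sub>0 int) \<Rightarrow> 'u" where
  "int_lincomb A c = finprod A (\<lambda>b. b [^]\<^bsub>A\<^esub> Poly_Mapping.lookup c b) (Poly_Mapping.keys c)"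

text \<open>A basis of a commutative monoid (abelian group) is a subset such that every element is a
  unique finite linear combination with natural (integer) coefficients.\<close>

definition is_basis :: "'u pgroup \<Rightarrow> 'u set \<Rightarrow> bool" where
  "is_basis A B \<longleftrightarrow> B \<subseteq> cone A \<and>
     bij_betw (nat_lincomb A) {c. Poly_Mapping.keys c \<subseteq> B} (cone A) \<and>
     bij_betw (int_lincomb A) {c. Poly_Mapping.keys c \<subseteq> B} (carrier A)"

definition is_meet :: "'u pgroup \<Rightarrow> 'u \<Rightarrow> 'u \<Rightarrow> 'u \<Rightarrow> bool" where
  "is_meet A a b m \<longleftrightarrow> (m, a) \<in> leq A \<and> (m, b) \<in> leq A \<and>
     (\<forall>l \<in> carrier A. (l, a) \<in> leq A \<and> (l, b) \<in> leq A \<longrightarrow> (l, m) \<in> leq A)"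

text \<open>Positive and negative parts are only used for groups with a basis, where the
  descriptions below are satisfied by exactly one element.\<close>

definition decomposes :: "'u pgroup \<Rightarrow> 'u \<Rightarrow> 'u \<Rightarrow> 'u \<Rightarrow> bool" where
  "decomposes A x p q \<longleftrightarrow>
     p \<in> cone A \<and> q \<in> cone A \<and> x = p \<otimes>\<^bsub>A\<^esub> inv\<^bsub>A\<^esub> q \<and> is_meet A p q \<one>\<^bsub>A\<^esub>"

definition pos_part :: "'u pgroup \<Rightarrow> 'u \<Rightarrow> 'u" where
  "pos_part A x = (THE p. \<exists>q. decomposes A x p q)"

definition neg_part :: "'u pgroup \<Rightarrow> 'u \<Rightarrow> 'u" where
  "neg_part A x = (THE q. \<exists>p. decomposes A x p q)"

text \<open>\<open>bd K n\<close> is the boundary map from degree \<open>Suc n\<close> to degree \<open>n\<close>.\<close>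

record 'u dcomplex =
  grp :: "nat \<Rightarrow> 'u pgroup"
  bd :: "nat \<Rightarrow> 'u \<Rightarrow> 'u"

record 'u adcomplex = "'u dcomplex" +
  aug :: "'u \<Rightarrow> int"

definition directed_chain_complex :: "('u, 'm) dcomplex_scheme \<Rightarrow> bool" where
  "directed_chain_complex K \<longleftrightarrow>
     (\<forall>n. preordered_abelian_group (grp K n)) \<and>
     (\<forall>n. bd K n \<in> hom (grp K (Suc n)) (grp K n)) \<and>
     (\<forall>n. \<forall>x \<in> carrier (grp K (Suc (Suc n))). bd K n (bd K (Suc n) x) = \<one>\<^bsub>grp K n\<^esub>)"

definition augmented_directed_complex :: "'u adcomplex \<Rightarrow> bool" where
  "augmented_directed_complex K \<longleftrightarrow> directed_chain_complex K \<and>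
     aug K \<in> hom (grp K 0) integer_group \<and>
     (\<forall>a \<in> carrier (grp K 0). \<forall>b \<in> carrier (grp K 0).
        (a, b) \<in> leq (grp K 0) \<longrightarrow> aug K a \<le> aug K b) \<and>
     (\<forall>x \<in> carrier (grp K 1). aug K (bd K 0 x) = 0)"

definition dcc_hom ::
  "('u, 'm) dcomplex_scheme \<Rightarrow> ('u, 'm) dcomplex_scheme \<Rightarrow> (nat \<Rightarrow> 'u \<Rightarrow> 'u) set" where
  "dcc_hom K L = {f.
     (\<forall>n. f n \<in> hom (grp K n) (grp L n) \<inter> extensional (carrier (grp K n))) \<and>
     (\<forall>n. \<forall>x \<in> carrier (grp K (Suc n)). bd L n (f (Suc n) x) = f n (bd K n x)) \<and>
     (\<forall>n. \<forall>a \<in> carrier (grp K n). \<forall>b \<in> carrier (grp K n).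
        (a, b) \<in> leq (grp K n) \<longrightarrow> (f n a, f n b) \<in> leq (grp L n))}"

definition adc_hom :: "'u adcomplex \<Rightarrow> 'u adcomplex \<Rightarrow> (nat \<Rightarrow> 'u \<Rightarrow> 'u) set" where
  "adc_hom K L = {f \<in> dcc_hom K L. \<forall>x \<in> carrier (grp K 0). aug L (f 0 x) = aug K x}"

definition ADC :: "('u adcomplex, nat \<Rightarrow> 'u \<Rightarrow> 'u) category" where
  "ADC = \<lparr>obj = {K. augmented_directed_complex K},
     arr = adc_hom,
     cmp = (\<lambda>K L M g f n. compose (carrier (grp K n)) (g n) (f n)),
     idn = (\<lambda>K n. \<lambda>x \<in> carrier (grp K n). x)\<rparr>"

definition bd_neg :: "('u, 'm) dcomplex_scheme \<Rightarrow> nat \<Rightarrow> 'u \<Rightarrow> 'u" where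
  "bd_neg K n x = neg_part (grp K n) (bd K n x)"

definition bd_pos :: "('u, 'm) dcomplex_scheme \<Rightarrow> nat \<Rightarrow> 'u \<Rightarrow> 'u" where
  "bd_pos K n x = pos_part (grp K n) (bd K n x)"

text \<open>The iterates \<open>(\<partial>\<^sup>-)\<^sup>n x\<close> and \<open>(\<partial>\<^sup>+)\<^sup>n x\<close> in degree \<open>0\<close>, for \<open>x\<close> of degree \<open>n\<close>.\<close>

fun bd_neg_iter :: "('u, 'm) dcomplex_scheme \<Rightarrow> nat \<Rightarrow> 'u \<Rightarrow> 'u" where
  "bd_neg_iter K 0 x = x"
| "bd_neg_iter K (Suc n) x = bd_neg_iter K n (bd_neg K n x)"

fun bd_pos_iter :: "('u, 'm) dcomplex_scheme \<Rightarrow> nat \<Rightarrow> 'u \<Rightarrow> 'u" where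
  "bd_pos_iter K 0 x = x"
| "bd_pos_iter K (Suc n) x = bd_pos_iter K n (bd_pos K n x)"

definition complex_basis :: "('u, 'm) dcomplex_scheme \<Rightarrow> (nat \<Rightarrow> 'u set) \<Rightarrow> bool" where
  "complex_basis K B \<longleftrightarrow> (\<forall>n. is_basis (grp K n) (B n))"

definition unital_basis :: "'u adcomplex \<Rightarrow> (nat \<Rightarrow> 'u set) \<Rightarrow> bool" where
  "unital_basis K B \<longleftrightarrow> (\<forall>n. \<forall>x \<in> B n.
     aug K (bd_neg_iter K n x) = 1 \<and> aug K (bd_pos_iter K n x) = 1)"

definition weakly_loop_free_basis :: "('u, 'm) dcomplex_scheme \<Rightarrow> (nat \<Rightarrow> 'u set) \<Rightarrow> bool" where
  "weakly_loop_free_basis K B \<longleftrightarrow> (\<forall>n. \<exists>r. partial_order_on (B (Suc n)) r \<and>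
     (\<forall>x \<in> B (Suc n). \<forall>y \<in> B (Suc n).
        \<not> is_meet (grp K n) (bd_pos K n x) (bd_neg K n y) \<one>\<^bsub>grp K n\<^esub> \<longrightarrow> (x, y) \<in> r))"

definition weak_steiner_complex :: "'u adcomplex \<Rightarrow> bool" where
  "weak_steiner_complex K \<longleftrightarrow> augmented_directed_complex K \<and>
     (\<exists>B. complex_basis K B \<and> unital_basis K B \<and> weakly_loop_free_basis K B)"

definition WSC :: "('u adcomplex, nat \<Rightarrow> 'u \<Rightarrow> 'u) category" where
  "WSC = full_subcategory ADC weak_steiner_complex"

end

theory Submission
  imports Defs
begin

text \<open>
  The functor sends a weak parity complex \<open>C\<close> to the free complex on its cells, with
  \<open>\<partial>x = x\<^sup>+ - x\<^sup>-\<close>, and a morphism \<open>f\<close> to the linear extension of \<open>x \<mapsto> \<Sum>f(x)\<close>. It is fully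
  faithful and essentially surjective because the chains that matter have no multiplicities: if
  \<open>x \<ge> 0\<close> is the top component of a Steiner cell in a complex with a weakly loop-free unital
  basis, then \<open>x\<close> is a sum of distinct basis elements whose negative boundaries are pairwise
  disjoint, and likewise for the positive boundaries. This is shown by induction on the degree and
  on the number of basis elements in \<open>x\<close>: a minimal element can be split off, and what remains is
  again the top component of a cell, with a source that is well-formed by induction. Since monotone
  chain maps preserve cells, all unions appearing in images and composites of morphisms are
  disjoint, hence agree with sums.
\<close>

text \<open>The definition of morphisms hides a circularity. The condition on a cell of degree
  \<open>Suc n\<close> speaks of unions of images of cells of degree \<open>n\<close>, while the
  boundary map sees their sums. Union and sum agree once the images of good chains are good, but
  good chains of degree \<open>n\<close> are known to be preserved only after commutation with the
  boundaries has been established up to degree \<open>n\<close>. Hence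
  \<open>good_frag_extend\<close> asks for commutation only below a given degree, and
  \<open>wpc_hom_iff\<close> turns the moving conditions into chain map equations by induction on
  the degree. Essential surjectivity rests on the same bound on coefficients. For a basis element
  \<open>b\<close> of positive degree the positive and negative parts of \<open>\<partial>b\<close>
  are good, so \<open>\<partial>b\<close> has coefficients -1, 0, 1 only and is determined by the
  supports of the two parts, which are all that a parity structure records.\<close>

section \<open>Fully faithful and essentially surjective functors\<close>

lemma
  assumes "is_category C"
  shows category_idn: "X \<in> obj C \<Longrightarrow> idn C X \<in> arr C X X"
    and category_cmp: "\<lbrakk>X \<in> obj C; Y \<in> obj C; Z \<in> obj C; f \<in> arr C X Y; g \<in> arr C Y Z\<rbrakk>
      \<Longrightarrow> cmp C X Y Z g f \<in> arr C X Z"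
    and category_idn_right: "\<lbrakk>X \<in> obj C; Y \<in> obj C; f \<in> arr C X Y\<rbrakk> \<Longrightarrow> cmp C X X Y f (idn C X) = f"
    and category_idn_left: "\<lbrakk>X \<in> obj C; Y \<in> obj C; f \<in> arr C X Y\<rbrakk> \<Longrightarrow> cmp C X Y Y (idn C Y) f = f"
    and category_assoc: "\<lbrakk>W \<in> obj C; X \<in> obj C; Y \<in> obj C; Z \<in> obj C;
        f \<in> arr C W X; g \<in> arr C X Y; h \<in> arr C Y Z\<rbrakk>
      \<Longrightarrow> cmp C W X Z (cmp C X Y Z h g) f = cmp C W Y Z h (cmp C W X Y g f)"
  using assms unfolding is_category_def by metis+

lemma
  assumes "is_functor C D F"
  shows functor_ob: "X \<in> obj C \<Longrightarrow> fob F X \<in> obj D"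
    and functor_ar: "\<lbrakk>X \<in> obj C; Y \<in> obj C; f \<in> arr C X Y\<rbrakk> \<Longrightarrow> far F X Y f \<in> arr D (fob F X) (fob F Y)"
    and functor_idn: "X \<in> obj C \<Longrightarrow> far F X X (idn C X) = idn D (fob F X)"
    and functor_cmp: "\<lbrakk>X \<in> obj C; Y \<in> obj C; Z \<in> obj C; f \<in> arr C X Y; g \<in> arr C Y Z\<rbrakk>
      \<Longrightarrow> far F X Z (cmp C X Y Z g f) =
        cmp D (fob F X) (fob F Y) (fob F Z) (far F Y Z g) (far F X Y f)"
  using assms unfolding is_functor_def by metis+

text \<open>The quasi-inverse sends \<open>Y\<close> to a chosen \<open>g Y\<close> whose image is
  isomorphic to \<open>Y\<close>, and an arrow to the unique preimage of its conjugate by the chosen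
  isomorphisms. Faithfulness lets every equation in \<open>C\<close> be checked after applying
  \<open>F\<close>.\<close>

lemma equivalent_categories_if_fully_faithful_surjective:
  assumes C: "is_category C" and D: "is_category D" and F: "is_functor C D F"
    and ff: "\<And>X Y. \<lbrakk>X \<in> obj C; Y \<in> obj C\<rbrakk>
      \<Longrightarrow> bij_betw (far F X Y) (arr C X Y) (arr D (fob F X) (fob F Y))"
    and es: "\<And>Y. Y \<in> obj D \<Longrightarrow> \<exists>X \<in> obj C. \<exists>e. isomorphism D (fob F X) Y e"
  shows "equivalent_categories C D"
proof -
  have "\<exists>X e e'. X \<in> obj C \<and> e \<in> arr D (fob F X) Y \<and> e' \<in> arr D Y (fob F X)
      \<and> cmp D (fob F X) Y (fob F X) e' e = idn D (fob F X) \<and> cmp D Y (fob F X) Y e e' = idn D Y"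
    if "Y \<in> obj D" for Y
    using es[OF that] unfolding isomorphism_def by blast
  then obtain g e e' where
    g: "\<And>Y. Y \<in> obj D \<Longrightarrow> g Y \<in> obj C" and
    e: "\<And>Y. Y \<in> obj D \<Longrightarrow> e Y \<in> arr D (fob F (g Y)) Y" and
    e': "\<And>Y. Y \<in> obj D \<Longrightarrow> e' Y \<in> arr D Y (fob F (g Y))" and
    e'e: "\<And>Y. Y \<in> obj D \<Longrightarrow>
      cmp D (fob F (g Y)) Y (fob F (g Y)) (e' Y) (e Y) = idn D (fob F (g Y))" and
    ee': "\<And>Y. Y \<in> obj D \<Longrightarrow> cmp D Y (fob F (g Y)) Y (e Y) (e' Y) = idn D Y"
    by metis
  define L where "L X Y h = inv_into (arr C X Y) (far F X Y) h" for X Y h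
  have L: "L X Y h \<in> arr C X Y" and FL: "far F X Y (L X Y h) = h"
    if "X \<in> obj C" "Y \<in> obj C" "h \<in> arr D (fob F X) (fob F Y)" for X Y h
    using ff[OF that(1,2)] that(3) unfolding L_def bij_betw_def
    by (auto intro: inv_into_into f_inv_into_f)
  have faithful: "u = v" if "X \<in> obj C" "Y \<in> obj C" "u \<in> arr C X Y" "v \<in> arr C X Y"
      "far F X Y u = far F X Y v" for X Y u v
    using ff[OF that(1,2)] that(3-) unfolding bij_betw_def inj_on_def by blast
  \<comment> \<open>Conjugation by the chosen isomorphisms gives an arrow between images under
    \<open>F\<close>, which can be lifted along \<open>F\<close>.\<close>
  define c where "c Y Y' h = cmp D (fob F (g Y)) Y' (fob F (g Y')) (e' Y')
    (cmp D (fob F (g Y)) Y Y' h (e Y))" for Y Y' h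
  define G where "G = \<lparr>fob = g, far = \<lambda>Y Y' h. L (g Y) (g Y') (c Y Y' h)\<rparr>"
  note ob = g functor_ob[OF F]
  note ar = ob e e' functor_ar[OF F] category_cmp[OF D] category_idn[OF D]
  note rules = category_assoc[OF D] category_idn_left[OF D] category_idn_right[OF D]
  have c: "c Y Y' h \<in> arr D (fob F (g Y)) (fob F (g Y'))"
    if "Y \<in> obj D" "Y' \<in> obj D" "h \<in> arr D Y Y'" for Y Y' h
    unfolding c_def using that by (intro ar)
  \<comment> \<open>Rewriting by associativity nests composites to the right, so the inverse laws
    are needed with a further arrow \<open>f\<close> behind them.\<close>
  have e'e_cmp: "cmp D W Y (fob F (g Y)) (e' Y) (cmp D W (fob F (g Y)) Y (e Y) f) = f"
    if "W \<in> obj D" "Y \<in> obj D" "f \<in> arr D W (fob F (g Y))" for W Y f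
    using category_assoc[OF D, of W "fob F (g Y)" Y "fob F (g Y)" f "e Y" "e' Y"] that e e' g e'e
    by (simp add: ob category_idn_left[OF D])
  have ee'_cmp: "cmp D W (fob F (g Y)) Y (e Y) (cmp D W Y (fob F (g Y)) (e' Y) f) = f"
    if "W \<in> obj D" "Y \<in> obj D" "f \<in> arr D W Y" for W Y f
    using category_assoc[OF D, of W Y "fob F (g Y)" Y f "e' Y" "e Y"] that e e' g ee'
    by (simp add: ob category_idn_left[OF D])
  have e_c: "cmp D (fob F (g Y)) (fob F (g Y')) Y' (e Y') (c Y Y' h)
      = cmp D (fob F (g Y)) Y Y' h (e Y)"
    if "Y \<in> obj D" "Y' \<in> obj D" "h \<in> arr D Y Y'" for Y Y' h
    unfolding c_def using that by (intro ee'_cmp ar)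
  have c_cmp: "c Y Y'' (cmp D Y Y' Y'' k h) =
      cmp D (fob F (g Y)) (fob F (g Y')) (fob F (g Y'')) (c Y' Y'' k) (c Y Y' h)"
    if "Y \<in> obj D" "Y' \<in> obj D" "Y'' \<in> obj D" "h \<in> arr D Y Y'" "k \<in> arr D Y' Y''" for Y Y' Y'' h k
  proof -
    have "cmp D (fob F (g Y)) (fob F (g Y')) (fob F (g Y'')) (c Y' Y'' k) (c Y Y' h)
      = cmp D (fob F (g Y)) Y'' (fob F (g Y'')) (e' Y'')
          (cmp D (fob F (g Y)) Y' Y'' k (cmp D (fob F (g Y)) (fob F (g Y')) Y' (e Y') (c Y Y' h)))"
      unfolding c_def[of Y' Y''] using that c[of Y Y' h] by (simp add: rules ar)
    then show ?thesis
      using that unfolding e_c[OF that(1,2,4)] by (simp add: c_def rules ar)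
  qed
  have c_idn: "c Y Y (idn D Y) = idn D (fob F (g Y))" if "Y \<in> obj D" for Y
    unfolding c_def using that by (simp add: rules ar e'e)
  have G: "is_functor D C G"
    unfolding is_functor_def G_def
  proof (intro conjI ballI, goal_cases)
    case (3 X)
    show ?case
      by (rule faithful[of "g X" "g X"]) (use 3 in \<open>simp_all add: L FL c c_idn ar category_idn[OF C] functor_idn[OF F]\<close>)
  next
    case (4 X Y Z f h)
    show ?case
      by (rule faithful[of "g X" "g Z"])
        (use 4 in \<open>simp_all add: L FL c c_cmp ar category_cmp[OF C] functor_cmp[OF F]\<close>)
  qed (simp_all add: g L c)
  have eps: "natural_isomorphism D D (comp_functor F G) id_functor e"
    unfolding natural_isomorphism_def comp_functor_def id_functor_def G_def isomorphism_def
    using e e' e'e ee' by (simp add: FL g c e_c) blast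
  \<comment> \<open>The unit points from \<open>X\<close> to \<open>g (fob F X)\<close>, so it lifts
    \<open>e'\<close>; the lift of \<open>e\<close> is its inverse.\<close>
  define \<eta> where "\<eta> X = L X (g (fob F X)) (e' (fob F X))" for X
  have \<eta>: "\<eta> X \<in> arr C X (g (fob F X))" "far F X (g (fob F X)) (\<eta> X) = e' (fob F X)"
    if "X \<in> obj C" for X
    unfolding \<eta>_def using that by (simp_all add: L FL ar)
  have "natural_isomorphism C C id_functor (comp_functor G F) \<eta>"
    unfolding natural_isomorphism_def
  proof (intro conjI ballI)
    fix X assume X: "X \<in> obj C"
    let ?Y = "g (fob F X)"
    have k: "L ?Y X (e (fob F X)) \<in> arr C ?Y X" "far F ?Y X (L ?Y X (e (fob F X))) = e (fob F X)"
      using X by (simp_all add: L FL ar)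
    have "cmp C X ?Y X (L ?Y X (e (fob F X))) (\<eta> X) = idn C X"
      by (rule faithful[of X X]) (use X k \<eta> in
        \<open>simp_all add: ar category_cmp[OF C] category_idn[OF C] functor_cmp[OF F] functor_idn[OF F] ee'\<close>)
    moreover have "cmp C ?Y X ?Y (\<eta> X) (L ?Y X (e (fob F X))) = idn C ?Y"
      by (rule faithful[of ?Y ?Y]) (use X k \<eta> in
        \<open>simp_all add: ar category_cmp[OF C] category_idn[OF C] functor_cmp[OF F] functor_idn[OF F] e'e\<close>)
    ultimately show "isomorphism C (fob id_functor X) (fob (comp_functor G F) X) (\<eta> X)"
      using k(1) \<eta>[OF X] unfolding isomorphism_def id_functor_def comp_functor_def G_def by auto
  next
    fix X Y f assume X: "X \<in> obj C" and Y: "Y \<in> obj C" and f: "f \<in> arr C X Y"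
    let ?X = "g (fob F X)" and ?Y = "g (fob F Y)"
    let ?h = "c (fob F X) (fob F Y) (far F X Y f)"
    have k: "L ?X ?Y ?h \<in> arr C ?X ?Y" "far F ?X ?Y (L ?X ?Y ?h) = ?h"
      using X Y f by (simp_all add: L FL ar c)
    have "cmp D (fob F X) (fob F ?X) (fob F ?Y) ?h (e' (fob F X))
        = cmp D (fob F X) (fob F Y) (fob F ?Y) (e' (fob F Y)) (far F X Y f)"
      unfolding c_def using X Y f by (simp add: rules ar ee')
    then have "cmp C X Y ?Y (\<eta> Y) f = cmp C X ?X ?Y (L ?X ?Y ?h) (\<eta> X)"
      by (intro faithful[of X ?Y]) (use X Y f k \<eta> in
        \<open>simp_all add: ar category_cmp[OF C] functor_cmp[OF F]\<close>)
    then show "cmp C (fob id_functor X) (fob id_functor Y) (fob (comp_functor G F) Y) (\<eta> Y) (far id_functor X Y f)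
      = cmp C (fob id_functor X) (fob (comp_functor G F) X) (fob (comp_functor G F) Y)
          (far (comp_functor G F) X Y f) (\<eta> X)"
      unfolding id_functor_def comp_functor_def G_def by simp
  qed
  with C D F G eps show ?thesis
    unfolding equivalent_categories_def by blast
qed

section \<open>Formal sums\<close>

abbreviation lk :: "('a \<Rightarrow>\<^sub>0 'b::zero) \<Rightarrow> 'a \<Rightarrow> 'b" where "lk \<equiv> Poly_Mapping.lookup"
abbreviation ky :: "('a \<Rightarrow>\<^sub>0 'b::zero) \<Rightarrow> 'a set" where "ky \<equiv> Poly_Mapping.keys"

definition nonneg :: "('a \<Rightarrow>\<^sub>0 int) \<Rightarrow> bool" where
  "nonneg x \<longleftrightarrow> (\<forall>b. 0 \<le> lk x b)"

definition coeff_sum :: "('a \<Rightarrow>\<^sub>0 int) \<Rightarrow> int" where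
  "coeff_sum x = (\<Sum>b\<in>ky x. lk x b)"

definition frag_pos :: "('a \<Rightarrow>\<^sub>0 int) \<Rightarrow> ('a \<Rightarrow>\<^sub>0 int)" where
  "frag_pos x = Poly_Mapping.map (max 0) x"

definition frag_neg :: "('a \<Rightarrow>\<^sub>0 int) \<Rightarrow> ('a \<Rightarrow>\<^sub>0 int)" where
  "frag_neg x = frag_pos (- x)"

text \<open>Sums over infinite sets are 0, so this is the indicator of \<open>S\<close> only for
  finite \<open>S\<close>; hence the finiteness assumptions below.\<close>

definition ind :: "'a set \<Rightarrow> ('a \<Rightarrow>\<^sub>0 int)" where
  "ind S = (\<Sum>b\<in>S. frag_of b)"

lemma lookup_frag_pos [simp]: "lk (frag_pos x) b = max 0 (lk x b)"
  unfolding frag_pos_def by (simp add: Poly_Mapping.map.rep_eq when_def)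

lemma lookup_frag_neg [simp]: "lk (frag_neg x) b = max 0 (- lk x b)"
  by (simp add: frag_neg_def)

lemma keys_frag_neg: "ky (frag_neg x) = {b. lk x b < 0}"
  by (auto simp: in_keys_iff)

lemma keys_frag_pos_subset: "ky (frag_pos x) \<subseteq> ky x"
  and keys_frag_neg_subset: "ky (frag_neg x) \<subseteq> ky x"
  by (auto simp: in_keys_iff)

lemma frag_neg_add: "frag_neg x + x = frag_pos x"
  by (rule poly_mapping_eqI) (simp add: lookup_add)

lemma frag_pos_minus_neg: "frag_pos x - frag_neg x = x"
  by (rule poly_mapping_eqI) (simp add: lookup_minus)

lemma nonneg_simps [simp]:
  "nonneg 0" "nonneg (frag_of b)" "nonneg (frag_pos x)" "nonneg (frag_neg x)"
  by (auto simp: nonneg_def)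

lemma frag_neg_0 [simp]: "frag_neg 0 = 0"
  and frag_pos_0 [simp]: "frag_pos 0 = 0"
  by (rule poly_mapping_eqI; simp)+

lemma coeff_sum_0 [simp]: "coeff_sum 0 = 0" and coeff_sum_frag_of [simp]: "coeff_sum (frag_of b) = 1"
  by (simp_all add: coeff_sum_def)

lemma coeff_sum_add: "coeff_sum (x + y) = coeff_sum x + coeff_sum y"
  unfolding coeff_sum_def by (rule setsum_keys_plus_distrib) auto

lemma coeff_sum_minus: "coeff_sum (- x) = - coeff_sum x"
  using coeff_sum_add[of x "- x"] by simp

lemma coeff_sum_diff: "coeff_sum (x - y) = coeff_sum x - coeff_sum y"
  using coeff_sum_add[of x "- y"] by (simp add: coeff_sum_minus)

lemma coeff_sum_nonneg: "nonneg x \<Longrightarrow> 0 \<le> coeff_sum x"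
  by (simp add: coeff_sum_def nonneg_def sum_nonneg)

lemma lookup_le_coeff_sum:
  assumes "nonneg x"
  shows "lk x b \<le> coeff_sum x"
proof (cases "b \<in> ky x")
  case True
  then show ?thesis
    using assms unfolding coeff_sum_def nonneg_def by (intro member_le_sum) auto
next
  case False
  then show ?thesis
    using assms by (simp add: in_keys_iff coeff_sum_nonneg)
qed

text \<open>This makes a good chain of degree 0 a single cell, as well-formedness in degree 0
  demands. After subtracting one element of the support, the rest is nonnegative with coefficient
  sum 0, hence 0.\<close>

lemma nonneg_coeff_sum_1:
  assumes "nonneg x" "coeff_sum x = 1"
  obtains b where "x = frag_of b"
proof -
  have "x \<noteq> 0"
    using assms by auto
  then obtain b where "b \<in> ky x"
    by (metis equals0I keys_eq_empty)
  then have b: "lk x b \<ge> 1"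
    using assms(1)[unfolded nonneg_def, rule_format, of b] by (simp add: in_keys_iff)
  define y where "y = x - frag_of b"
  have "nonneg y"
    using assms(1) b by (auto simp: nonneg_def y_def lookup_minus)
  moreover have "coeff_sum y = 0"
    using assms(2) by (simp add: y_def coeff_sum_diff)
  ultimately have "y = 0"
    using lookup_le_coeff_sum[of y] by (intro poly_mapping_eqI) (auto simp: nonneg_def intro: order.antisym)
  then show thesis
    using that by (simp add: y_def)
qed

lemma coeff_sum_sum: "coeff_sum (sum g A) = (\<Sum>a\<in>A. coeff_sum (g a))"
  by (induction A rule: infinite_finite_induct) (simp_all add: coeff_sum_add)

lemma coeff_sum_cmul: "coeff_sum (frag_cmul k x) = k * coeff_sum x"
  unfolding coeff_sum_def sum_distrib_left lookup_frag_cmul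
  by (rule sum.mono_neutral_left) (auto simp: in_keys_iff)

lemma coeff_sum_frag_extend: "coeff_sum (frag_extend f x) = (\<Sum>b\<in>ky x. lk x b * coeff_sum (f b))"
  by (simp add: frag_extend_def coeff_sum_sum coeff_sum_cmul)

lemma coeff_sum_frag_extend_1: "(\<And>b. b \<in> ky x \<Longrightarrow> coeff_sum (f b) = 1) \<Longrightarrow> coeff_sum (frag_extend f x) = coeff_sum x"
  by (simp add: coeff_sum_frag_extend) (simp add: coeff_sum_def)

lemma lookup_frag_extend: "lk (frag_extend f x) c = (\<Sum>b\<in>ky x. lk x b * lk (f b) c)"
  by (simp add: frag_extend_def lookup_sum)

lemma keys_frag_extend_subset:
  "\<lbrakk>ky x \<subseteq> A; \<And>a. a \<in> A \<Longrightarrow> ky (f a) \<subseteq> S\<rbrakk> \<Longrightarrow> ky (frag_extend f x) \<subseteq> S"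
  using keys_frag_extend[of f x] by blast

lemma nonneg_frag_extend:
  "\<lbrakk>nonneg x; \<And>a. a \<in> ky x \<Longrightarrow> nonneg (f a)\<rbrakk> \<Longrightarrow> nonneg (frag_extend f x)"
  by (simp add: nonneg_def lookup_frag_extend sum_nonneg)

lemma frag_extend_extend:
  "frag_extend f (frag_extend g x) = frag_extend (\<lambda>a. frag_extend f (g a)) x"
  by (induction x rule: frag_induction[OF subset_UNIV]) (auto simp: frag_extend_diff)

lemma frag_extend_frag_of: "(\<And>a. a \<in> ky x \<Longrightarrow> f a = frag_of a) \<Longrightarrow> frag_extend f x = x"
  using frag_extend_eq[of x f frag_of] frag_expansion[of x] by simp

lemma lookup_ind: "finite S \<Longrightarrow> lk (ind S) b = (if b \<in> S then 1 else 0)"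
  by (simp add: ind_def lookup_sum)

lemma keys_ind: "finite S \<Longrightarrow> ky (ind S) = S"
  by (rule Set.set_eqI) (simp add: in_keys_iff lookup_ind)

lemma ind_simps [simp]: "ind {} = 0" "ind {b} = frag_of b"
  by (simp_all add: ind_def)

lemma nonneg_ind [simp]: "nonneg (ind S)"
  unfolding nonneg_def ind_def lookup_sum by (auto intro: sum_nonneg)

lemma frag_extend_ind: "finite S \<Longrightarrow> frag_extend f (ind S) = (\<Sum>a\<in>S. f a)"
  by (simp add: ind_def frag_extend_sum o_def)

lemma ind_keys:
  assumes "nonneg x" "\<And>b. lk x b \<le> 1"
  shows "ind (ky x) = x"
proof (rule poly_mapping_eqI)
  fix b
  show "lk (ind (ky x)) b = lk x b"
    using assms(2)[of b] assms(1)[unfolded nonneg_def, rule_format, of b]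
    by (auto simp: lookup_ind in_keys_iff)
qed

text \<open>The coefficient of \<open>c\<close> in the sum counts the \<open>a\<close> in
  \<open>S\<close> with \<open>c\<close> in \<open>f a\<close>. The bound 1 thus takes the place of
  a disjointness assumption, in a form that good chains provide.\<close>

lemma frag_extend_ind_Union:
  assumes "finite S" "\<And>a. a \<in> S \<Longrightarrow> finite (f a)"
    and "\<And>c. lk (frag_extend (\<lambda>a. ind (f a)) (ind S)) c \<le> 1"
  shows "frag_extend (\<lambda>a. ind (f a)) (ind S) = ind (\<Union>a\<in>S. f a)"
proof (rule poly_mapping_eqI)
  fix c
  let ?s = "\<Sum>a\<in>S. lk (ind (f a)) c"
  have s: "lk (frag_extend (\<lambda>a. ind (f a)) (ind S)) c = ?s"
    using assms(1) by (simp add: frag_extend_ind lookup_sum)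
  have "?s = (if c \<in> (\<Union>a\<in>S. f a) then 1 else 0)"
  proof (cases "c \<in> (\<Union>a\<in>S. f a)")
    case True
    then obtain a where a: "a \<in> S" "c \<in> f a"
      by blast
    have "lk (ind (f a)) c \<le> ?s"
      using a(1) assms(1) nonneg_ind[of "f x" for x] unfolding nonneg_def by (intro member_le_sum) auto
    then have "1 \<le> ?s"
      using a assms(2)[OF a(1)] by (simp add: lookup_ind)
    then show ?thesis
      using True assms(3)[of c] s by simp
  next
    case False
    then show ?thesis
      using assms(2) by (intro trans[OF sum.neutral]) (auto simp: lookup_ind)
  qed
  then show "lk (frag_extend (\<lambda>a. ind (f a)) (ind S)) c = lk (ind (\<Union>a\<in>S. f a)) c"
    using s assms(1,2) by (simp add: lookup_ind)
qed

section \<open>Free chain complexes\<close>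

text \<open>\<open>good B d n x\<close> says that \<open>x\<close> is the top component of an \<open>n\<close>-cell in the sense of Steiner:
  the witness \<open>y\<close> is the source in the next lower degree, and \<open>y + \<partial>x\<close> is the target.\<close>

fun good :: "(nat \<Rightarrow> 'a set) \<Rightarrow> (nat \<Rightarrow> 'a \<Rightarrow> 'a \<Rightarrow>\<^sub>0 int) \<Rightarrow> nat \<Rightarrow> ('a \<Rightarrow>\<^sub>0 int) \<Rightarrow> bool" where
  "good B d 0 x \<longleftrightarrow> nonneg x \<and> ky x \<subseteq> B 0 \<and> coeff_sum x = 1"
| "good B d (Suc n) x \<longleftrightarrow> nonneg x \<and> ky x \<subseteq> B (Suc n) \<and>
     (\<exists>y. good B d n y \<and> nonneg (y + frag_extend (d n) x))"

lemma good_nonneg: "good B d n x \<Longrightarrow> nonneg x"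
  and good_keys: "good B d n x \<Longrightarrow> ky x \<subseteq> B n"
  by (cases n; auto)+

fun neg_iter :: "(nat \<Rightarrow> 'a \<Rightarrow> 'a \<Rightarrow>\<^sub>0 int) \<Rightarrow> nat \<Rightarrow> ('a \<Rightarrow>\<^sub>0 int) \<Rightarrow> ('a \<Rightarrow>\<^sub>0 int)" where
  "neg_iter d 0 x = x"
| "neg_iter d (Suc n) x = neg_iter d n (frag_neg (frag_extend (d n) x))"

fun pos_iter :: "(nat \<Rightarrow> 'a \<Rightarrow> 'a \<Rightarrow>\<^sub>0 int) \<Rightarrow> nat \<Rightarrow> ('a \<Rightarrow>\<^sub>0 int) \<Rightarrow> ('a \<Rightarrow>\<^sub>0 int)" where
  "pos_iter d 0 x = x"
| "pos_iter d (Suc n) x = pos_iter d n (frag_pos (frag_extend (d n) x))"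

text \<open>The values of \<open>d n\<close> off \<open>B (Suc n)\<close> are unconstrained. This is
  why chains carry assumptions on their support, and why boundaries agreeing on the basis are
  exchanged by congruence lemmas.\<close>

locale free_complex =
  fixes B :: "nat \<Rightarrow> 'a set" and d :: "nat \<Rightarrow> 'a \<Rightarrow> 'a \<Rightarrow>\<^sub>0 int"
  assumes keys_d: "b \<in> B (Suc n) \<Longrightarrow> ky (d n b) \<subseteq> B n"
    and dd: "b \<in> B (Suc (Suc n)) \<Longrightarrow> frag_extend (d n) (d (Suc n) b) = 0"
    and coeff_sum_d: "b \<in> B (Suc 0) \<Longrightarrow> coeff_sum (d 0 b) = 0"
begin

lemma keys_bd: "ky x \<subseteq> B (Suc n) \<Longrightarrow> ky (frag_extend (d n) x) \<subseteq> B n"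
  by (rule keys_frag_extend_subset) (auto dest: keys_d)

lemma bd_bd: "ky x \<subseteq> B (Suc (Suc n)) \<Longrightarrow> frag_extend (d n) (frag_extend (d (Suc n)) x) = 0"
  unfolding frag_extend_extend using dd by (rule frag_extend_eq_0) auto

lemma coeff_sum_bd: "ky x \<subseteq> B (Suc 0) \<Longrightarrow> coeff_sum (frag_extend (d 0) x) = 0"
  unfolding coeff_sum_frag_extend using coeff_sum_d by (intro sum.neutral) auto

text \<open>Whether a nonnegative chain is good depends only on its boundary (in degree \<open>0\<close>, on its
  augmentation), which does not change when another boundary is added.\<close>

lemma good_add_bd:
  assumes "good B d n y" "ky x \<subseteq> B (Suc n)" "nonneg (y + frag_extend (d n) x)"
  shows "good B d n (y + frag_extend (d n) x)"
proof -
  have "ky (y + frag_extend (d n) x) \<subseteq> B n"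
    using keys_add[of y "frag_extend (d n) x"] good_keys[OF assms(1)] keys_bd[OF assms(2)] by blast
  with assms show ?thesis
    by (cases n) (auto simp: coeff_sum_add coeff_sum_bd frag_extend_add bd_bd)
qed

text \<open>The negative part of the boundary is the smallest possible source, and it is good by
  induction. Adding the boundary to it yields the positive part, which is nonnegative.\<close>

lemma good_if_neg_iter:
  "\<lbrakk>nonneg x; ky x \<subseteq> B n; coeff_sum (neg_iter d n x) = 1\<rbrakk> \<Longrightarrow> good B d n x"
proof (induction n arbitrary: x)
  case (Suc n)
  have "good B d n (frag_neg (frag_extend (d n) x))"
    using Suc.prems subset_trans[OF keys_frag_neg_subset keys_bd[OF Suc.prems(2)]] by (intro Suc.IH) simp_all
  then show ?case
    using Suc.prems by (auto intro!: exI[of _ "frag_neg (frag_extend (d n) x)"] simp: frag_neg_add)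
qed simp

text \<open>The hypothesis controls targets, whereas \<open>good\<close> asks for a source. The
  target \<open>frag_pos\<close> is good by induction, and adding the boundary of \<open>- x\<close>
  to it leads back to the source \<open>frag_neg\<close>.\<close>

lemma good_if_pos_iter:
  "\<lbrakk>nonneg x; ky x \<subseteq> B n; coeff_sum (pos_iter d n x) = 1\<rbrakk> \<Longrightarrow> good B d n x"
proof (induction n arbitrary: x)
  case (Suc n)
  let ?d = "frag_extend (d n) x"
  have g: "good B d n (frag_pos ?d)"
    using Suc.prems subset_trans[OF keys_frag_pos_subset keys_bd[OF Suc.prems(2)]] by (intro Suc.IH) simp_all
  have "frag_pos ?d + frag_extend (d n) (- x) = frag_neg ?d"
    using frag_pos_minus_neg[of ?d] by (simp add: frag_extend_minus algebra_simps)
  then have "good B d n (frag_neg ?d)"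
    using good_add_bd[OF g, of "- x"] Suc.prems by simp
  then show ?case
    using Suc.prems by (auto intro!: exI[of _ "frag_neg ?d"] simp: frag_neg_add)
qed simp

end

text \<open>The minimal element \<open>b\<close> of a chain \<open>x\<close> leading from \<open>y\<close> can be split off: no other element
  produces what \<open>b\<close> consumes, so \<open>y\<close> already contains all of it.\<close>

lemma sum_neg_le_1:
  fixes D :: "'a \<Rightarrow> 'a \<Rightarrow>\<^sub>0 int"
  assumes po: "partial_order_on S r"
    and loop_free: "\<And>a b c. \<lbrakk>a \<in> S; b \<in> S; lk (D a) c > 0; lk (D b) c < 0\<rbrakk> \<Longrightarrow> (a, b) \<in> r"
    and le_1: "\<And>y c. G y \<Longrightarrow> lk y c \<le> 1" and nn: "\<And>y. G y \<Longrightarrow> nonneg y"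
    and closed: "\<And>y x. \<lbrakk>G y; ky x \<subseteq> S; nonneg (y + frag_extend D x)\<rbrakk> \<Longrightarrow> G (y + frag_extend D x)"
  shows "\<lbrakk>nonneg x; ky x \<subseteq> S; G y; nonneg (y + frag_extend D x)\<rbrakk>
    \<Longrightarrow> lk (frag_extend (\<lambda>a. frag_neg (D a)) x) c \<le> 1"
\<comment> \<open>The measure counts with multiplicity, because \<open>x\<close> may still contain
  an element several times.\<close>
proof (induction "nat (coeff_sum x)" arbitrary: x y)
  case 0
  then have "coeff_sum x = 0"
    using coeff_sum_nonneg by force
  then have "x = 0"
    using lookup_le_coeff_sum[OF "0.prems"(1)] "0.prems"(1)
    by (intro poly_mapping_eqI) (auto simp: nonneg_def intro: order.antisym)
  then show ?case
    by simp
next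
  case (Suc k)
  have x_pos: "lk x a > 0" if "a \<in> ky x" for a
    using Suc.prems(1)[unfolded nonneg_def, rule_format, of a] that by (simp add: in_keys_iff)
  have "ky x \<noteq> {}"
    using Suc.hyps(2) by auto
  moreover have "asymp_on (ky x) (\<lambda>a b. (a, b) \<in> r \<and> a \<noteq> b)" "transp_on (ky x) (\<lambda>a b. (a, b) \<in> r \<and> a \<noteq> b)"
    using po unfolding partial_order_on_def preorder_on_def antisym_def trans_def
    by (auto simp: asymp_on_def transp_on_def)
  ultimately obtain b where b: "b \<in> ky x" and min: "\<And>a. \<lbrakk>a \<in> ky x; (a, b) \<in> r\<rbrakk> \<Longrightarrow> a = b"
    using Finite_Set.bex_min_element[of "ky x" "\<lambda>a b. (a, b) \<in> r \<and> a \<noteq> b"] by fastforce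
  have nonpos: "lk (D a) c \<le> 0" if "a \<in> ky x" "lk (D b) c < 0" for a c
  proof (rule ccontr)
    assume "\<not> lk (D a) c \<le> 0"
    then have "(a, b) \<in> r"
      using loop_free[of a b c] that b Suc.prems(2) by auto
    then show False
      using min[OF that(1)] that(2) \<open>\<not> lk (D a) c \<le> 0\<close> by simp
  qed
  define x' where "x' = x - frag_of b"
  have x: "x = frag_of b + x'"
    by (simp add: x'_def)
  have nn_x': "nonneg x'"
    using Suc.prems(1) x_pos[OF b] by (auto simp: nonneg_def x'_def lookup_minus)
  have keys_x': "ky x' \<subseteq> S"
    using keys_diff[of x "frag_of b"] b Suc.prems(2) by (auto simp: x'_def)
  have b_in: "b \<in> S"
    using b Suc.prems(2) by blast
  have "0 \<le> lk (y + D b) c" for c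
  proof (cases "lk (D b) c < 0")
    case True
    have "lk (frag_extend D x') c \<le> 0"
      unfolding lookup_frag_extend
    proof (rule sum_nonpos)
      fix a assume "a \<in> ky x'"
      then have "a \<in> ky x"
        using keys_diff[of x "frag_of b"] b by (auto simp: x'_def)
      then show "lk x' a * lk (D a) c \<le> 0"
        using nonpos True nn_x' by (simp add: nonneg_def mult_nonneg_nonpos)
    qed
    moreover have "0 \<le> lk y c + lk (D b) c + lk (frag_extend D x') c"
      using Suc.prems(4) by (simp add: nonneg_def x frag_extend_add lookup_add add.assoc)
    ultimately show ?thesis
      by (simp add: lookup_add)
  next
    case False
    then show ?thesis
      using nn[OF Suc.prems(3)] by (simp add: nonneg_def lookup_add)
  qed
  \<comment> \<open>After \<open>b\<close> has been carried out, the rest \<open>x'\<close> leads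
    from \<open>y + D b\<close> to the same target, so the induction hypothesis applies to this new
    source.\<close>
  then have G': "G (y + D b)"
    using closed[OF Suc.prems(3), of "frag_of b"] b_in by (simp add: nonneg_def)
  have "k = nat (coeff_sum x')"
    using Suc.hyps(2) by (simp add: x'_def coeff_sum_diff)
  then have IH: "lk (frag_extend (\<lambda>a. frag_neg (D a)) x') c \<le> 1"
    using Suc.hyps(1)[OF _ nn_x' keys_x' G'] Suc.prems(4) by (simp add: x frag_extend_add add.assoc)
  show ?case
  proof (cases "lk (D b) c < 0")
    case True
    \<comment> \<open>Where \<open>b\<close> consumes, no element of \<open>x\<close> produces. The
      total consumption is then the net loss, which the supply in \<open>y\<close> has to
      cover.\<close>
    have "lk (frag_extend (\<lambda>a. frag_neg (D a)) x) c = - lk (frag_extend D x) c"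
      unfolding lookup_frag_extend sum_negf[symmetric]
      using nonpos[OF _ True] by (intro sum.cong) auto
    also have "\<dots> \<le> lk y c"
      using Suc.prems(4)[unfolded nonneg_def, rule_format, of c] by (simp add: lookup_add)
    finally show ?thesis
      using le_1[OF Suc.prems(3), of c] by simp
  next
    case False
    then show ?thesis
      using IH by (simp add: x frag_extend_add lookup_add)
  qed
qed

section \<open>Multiplicities over a weakly loop-free unital basis\<close>

lemma neg_iter_0 [simp]: "neg_iter d n 0 = 0"
  by (induction n) simp_all

lemma pos_iter_0 [simp]: "pos_iter d n 0 = 0"
  by (induction n) simp_all

lemma frag_extend_uminus: "frag_extend (\<lambda>a. - f a) x = - frag_extend f x"
  by (rule poly_mapping_eqI) (simp add: lookup_frag_extend sum_negf)

text \<open>The conditions on a weak Steiner complex, in coordinates: the meet of a positive and a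
  negative boundary is nonzero exactly when some \<open>c\<close> has opposite signs in the two
  boundaries.\<close>

locale steiner = free_complex +
  assumes unital_neg: "b \<in> B n \<Longrightarrow> coeff_sum (neg_iter d n (frag_of b)) = 1"
    and unital_pos: "b \<in> B n \<Longrightarrow> coeff_sum (pos_iter d n (frag_of b)) = 1"
    and loop_free: "\<exists>r. partial_order_on (B (Suc n)) r \<and> (\<forall>a \<in> B (Suc n). \<forall>b \<in> B (Suc n).
      (\<exists>c. lk (d n a) c > 0 \<and> lk (d n b) c < 0) \<longrightarrow> (a, b) \<in> r)"
begin

lemma good_frag_of: "b \<in> B n \<Longrightarrow> good B d n (frag_of b)"
  using unital_neg by (intro good_if_neg_iter) auto

lemma good_neg_d:
  assumes "b \<in> B (Suc n)"
  shows "good B d n (frag_neg (d n b))"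
  using unital_neg[OF assms] subset_trans[OF keys_frag_neg_subset keys_d[OF assms]]
  by (intro good_if_neg_iter) simp_all

lemma good_pos_d:
  assumes "b \<in> B (Suc n)"
  shows "good B d n (frag_pos (d n b))"
  using unital_pos[OF assms] subset_trans[OF keys_frag_pos_subset keys_d[OF assms]]
  by (intro good_if_pos_iter) simp_all

text \<open>Otherwise the negative part of the boundary would be 0 and its iterated augmentation 0
  instead of 1.\<close>

lemma ex_neg_d:
  assumes "b \<in> B (Suc n)"
  obtains c where "lk (d n b) c < 0"
proof -
  have "frag_neg (d n b) \<noteq> 0"
    using unital_neg[OF assms] by auto
  then have "ky (frag_neg (d n b)) \<noteq> {}"
    by simp
  then show thesis
    using that keys_frag_neg[of "d n b"] by auto
qed

text \<open>The passage from degree \<open>n\<close> to degree \<open>Suc n\<close>: the bound on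
  good chains of degree \<open>n\<close> is kept as a hypothesis, since it becomes available only
  inside the induction that proves \<open>good_le_1\<close>.\<close>

lemma sum_d_le_1_step:
  assumes le_1: "\<And>y c. good B d n y \<Longrightarrow> lk y c \<le> 1" and x: "good B d (Suc n) x"
  shows "lk (frag_extend (\<lambda>a. frag_neg (d n a)) x) c \<le> 1"
    and "lk (frag_extend (\<lambda>a. frag_pos (d n a)) x) c \<le> 1"
proof -
  obtain r where r: "partial_order_on (B (Suc n)) r"
    and lf: "\<And>a b c. \<lbrakk>a \<in> B (Suc n); b \<in> B (Suc n); lk (d n a) c > 0; lk (d n b) c < 0\<rbrakk> \<Longrightarrow> (a, b) \<in> r"
    using loop_free[of n] by blast
  obtain y where y: "good B d n y" "nonneg (y + frag_extend (d n) x)"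
    and nn: "nonneg x" and ky: "ky x \<subseteq> B (Suc n)"
    using x by auto
  show "lk (frag_extend (\<lambda>a. frag_neg (d n a)) x) c \<le> 1"
    by (rule sum_neg_le_1[where G = "good B d n", OF r lf le_1 _ good_add_bd nn ky y])
      (auto intro: good_nonneg)
  have G: "good B d n (z + frag_extend (\<lambda>a. - d n a) u)"
    if "good B d n z" "ky u \<subseteq> B (Suc n)" "nonneg (z + frag_extend (\<lambda>a. - d n a) u)" for z u
    using good_add_bd[OF that(1), of "- u"] that(2,3) by (simp add: frag_extend_uminus frag_extend_minus)
  \<comment> \<open>Producing is consuming for \<open>- d\<close>: the order is reversed, and the
    chain is run backwards from its target \<open>y + \<partial>x\<close>.\<close>
  have "lk (frag_extend (\<lambda>a. frag_neg (- d n a)) x) c \<le> 1"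
    by (rule sum_neg_le_1[where G = "good B d n" and r = "r\<inverse>" and y = "y + frag_extend (d n) x",
          OF _ _ le_1 _ G nn ky good_add_bd[OF y(1) ky y(2)]])
      (use r lf y good_nonneg in \<open>auto simp: frag_extend_uminus\<close>)
  then show "lk (frag_extend (\<lambda>a. frag_pos (d n a)) x) c \<le> 1"
    by (simp add: frag_neg_def)
qed

text \<open>Every basis element of positive degree consumes some \<open>e\<close> one degree lower,
  so its multiplicity in \<open>x\<close> is at most the total consumption of \<open>e\<close>,
  which the previous lemma bounds by 1.\<close>

lemma good_le_1: "good B d n x \<Longrightarrow> lk x c \<le> 1"
proof (induction n arbitrary: x c)
  case 0
  then show ?case
    using lookup_le_coeff_sum[of x c] by simp
next
  case (Suc n)
  note nn = good_nonneg[OF Suc.prems]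
  show ?case
  proof (cases "c \<in> ky x")
    case True
    then obtain e where e: "lk (d n c) e < 0"
      using ex_neg_d good_keys[OF Suc.prems] by blast
    have "lk x c \<le> lk x c * lk (frag_neg (d n c)) e"
      using e nn mult_left_mono[of 1 "lk (frag_neg (d n c)) e" "lk x c"] by (simp add: nonneg_def)
    also have "\<dots> \<le> lk (frag_extend (\<lambda>a. frag_neg (d n a)) x) e"
      unfolding lookup_frag_extend using True nn by (intro member_le_sum) (auto simp: nonneg_def)
    finally show ?thesis
      using sum_d_le_1_step(1)[OF Suc.IH Suc.prems, of e] by simp
  qed (simp add: in_keys_iff)
qed

lemma sum_d_le_1:
  assumes "good B d (Suc n) x"
  shows "lk (frag_extend (\<lambda>a. frag_neg (d n a)) x) c \<le> 1"
    and "lk (frag_extend (\<lambda>a. frag_pos (d n a)) x) c \<le> 1"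
  using sum_d_le_1_step assms good_le_1 by blast+

lemma good_ind: "good B d n x \<Longrightarrow> ind (ky x) = x"
  by (rule ind_keys) (auto intro: good_nonneg good_le_1)

text \<open>Two distinct elements of \<open>S\<close> with a common point \<open>c\<close> in their
  negative, or in their positive, boundaries would contribute 2 to a coefficient that is at most
  1.\<close>

lemma good_ind_eq:
  assumes "good B d n (ind S)" "finite S" "a \<in> S" "b \<in> S" "n = Suc m"
    and "lk (d m a) c > 0 \<and> lk (d m b) c > 0 \<or> lk (d m a) c < 0 \<and> lk (d m b) c < 0"
  shows "a = b"
proof (rule ccontr)
  assume "a \<noteq> b"
  have *: "(\<Sum>s\<in>{a,b}. lk (f s) c) \<le> lk (frag_extend f (ind S)) c" if "\<And>s. nonneg (f s)" for f :: "'a \<Rightarrow> 'a \<Rightarrow>\<^sub>0 int"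
    unfolding frag_extend_ind[OF assms(2)] lookup_sum
    by (rule sum_mono2) (use assms(2-4) that in \<open>auto simp: nonneg_def\<close>)
  show False
    using *[of "\<lambda>s. frag_pos (d m s)"] *[of "\<lambda>s. frag_neg (d m s)"] \<open>a \<noteq> b\<close> assms(6)
      sum_d_le_1[OF assms(1)[unfolded assms(5)], of c] by auto
qed

end

section \<open>Weak parity complexes as free complexes\<close>

definition boundary :: "'u parity \<Rightarrow> nat \<Rightarrow> 'u \<Rightarrow> 'u \<Rightarrow>\<^sub>0 int" where
  "boundary C n x = ind (pos C n x) - ind (neg C n x)"

lemma parity_structureD:
  assumes "parity_structure C" "x \<in> cells C (Suc n)"
  shows "finite (neg C n x)" "finite (pos C n x)" "neg C n x \<subseteq> cells C n" "pos C n x \<subseteq> cells C n"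
    "neg C n x \<inter> pos C n x = {}"
  using assms unfolding parity_structure_def Fpow_def by blast+

lemma
  assumes "parity_structure C" "x \<in> cells C (Suc n)"
  shows lookup_boundary_pos: "lk (boundary C n x) c > 0 \<longleftrightarrow> c \<in> pos C n x"
    and lookup_boundary_neg: "lk (boundary C n x) c < 0 \<longleftrightarrow> c \<in> neg C n x"
    and frag_neg_boundary: "frag_neg (boundary C n x) = ind (neg C n x)"
    and frag_pos_boundary: "frag_pos (boundary C n x) = ind (pos C n x)"
    and keys_boundary: "ky (boundary C n x) \<subseteq> cells C n"
proof -
  note p = parity_structureD[OF assms]
  have lk: "lk (boundary C n x) c = (if c \<in> pos C n x then 1 else if c \<in> neg C n x then - 1 else 0)" for c
    using p(5) by (auto simp: boundary_def lookup_minus lookup_ind p(1,2))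
  show "lk (boundary C n x) c > 0 \<longleftrightarrow> c \<in> pos C n x" "lk (boundary C n x) c < 0 \<longleftrightarrow> c \<in> neg C n x"
    using p(5) by (auto simp: lk)
  show "frag_neg (boundary C n x) = ind (neg C n x)" "frag_pos (boundary C n x) = ind (pos C n x)"
    using p(5) by (auto simp: lk lookup_ind p(1,2) intro!: poly_mapping_eqI)
  show "ky (boundary C n x) \<subseteq> cells C n"
    using p(3,4) by (auto simp: in_keys_iff lk split: if_splits)
qed

lemma sum_ind_Union:
  "\<lbrakk>finite S; \<And>a. a \<in> S \<Longrightarrow> finite (f a); \<And>a b. \<lbrakk>a \<in> S; b \<in> S; a \<noteq> b\<rbrakk> \<Longrightarrow> f a \<inter> f b = {}\<rbrakk>
    \<Longrightarrow> (\<Sum>a\<in>S. ind (f a)) = ind (\<Union>a\<in>S. f a)"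
  unfolding ind_def by (rule sum.UNION_disjoint[symmetric]) auto

text \<open>Well-formedness makes the unions in \<open>negs\<close> and \<open>poss\<close>
  disjoint, so the boundary of \<open>ind S\<close> is a difference of two indicators, and
  cancellation of coefficients becomes set difference.\<close>

lemma
  assumes C: "parity_structure C" and S: "finite S" "well_formed C (Suc n) S"
  shows finite_mp: "finite (mp C n S)" and finite_pm: "finite (pm C n S)"
    and frag_neg_bd_ind: "frag_neg (frag_extend (boundary C n) (ind S)) = ind (mp C n S)"
    and frag_pos_bd_ind: "frag_pos (frag_extend (boundary C n) (ind S)) = ind (pm C n S)"
proof -
  have sub: "S \<subseteq> cells C (Suc n)"
    using S(2) by simp
  note p = parity_structureD[OF C subsetD[OF sub]]
  have fin: "finite (poss C n S)" "finite (negs C n S)"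
    using S(1) p unfolding poss_def negs_def by auto
  then show "finite (mp C n S)" "finite (pm C n S)"
    unfolding mp_def pm_def by auto
  have "(\<Sum>a\<in>S. ind (pos C n a)) = ind (poss C n S)" "(\<Sum>a\<in>S. ind (neg C n a)) = ind (negs C n S)"
    using S(2) unfolding poss_def negs_def by (intro sum_ind_Union S(1) p; force)+
  then have bd: "frag_extend (boundary C n) (ind S) = ind (poss C n S) - ind (negs C n S)"
    by (simp add: frag_extend_ind[OF S(1)] boundary_def sum_subtractf)
  show "frag_neg (frag_extend (boundary C n) (ind S)) = ind (mp C n S)"
    "frag_pos (frag_extend (boundary C n) (ind S)) = ind (pm C n S)"
    unfolding bd mp_def pm_def
    by (rule poly_mapping_eqI; simp add: lookup_minus lookup_ind fin)+
qed

lemma mu_self [simp]: "mu C n x n = {x}"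
  and pi_sets_self [simp]: "pi_sets C n x n = {x}"
  by (subst mu.simps pi_sets.simps, simp)+

lemma mu_less: "k < n \<Longrightarrow> mu C n x k = mp C k (mu C n x (Suc k))"
  and pi_sets_less: "k < n \<Longrightarrow> pi_sets C n x k = pm C k (pi_sets C n x (Suc k))"
  by (subst mu.simps pi_sets.simps, simp)+

lemma
  assumes "parity_structure C" "x \<in> cells C (Suc n)"
  shows mu_neg: "mu C (Suc n) x n = neg C n x" and pi_sets_pos: "pi_sets C (Suc n) x n = pos C n x"
  using parity_structureD(5)[OF assms] by (auto simp: mu_less pi_sets_less mp_def pm_def negs_def poss_def)

text \<open>As long as the set in degree \<open>Suc k\<close> is well-formed, passing to degree
  \<open>k\<close> is one application of the negative boundary. At \<open>k = 0\<close> the left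
  side is the indicator of \<open>mu C n x 0\<close>, which connects the augmentation condition with
  the singleton condition.\<close>

lemma neg_iter_mu:
  assumes "parity_structure C" "\<And>k. k \<le> n \<Longrightarrow> well_formed C k (mu C n x k)" "k \<le> n"
  shows "neg_iter (boundary C) k (ind (mu C n x k)) = neg_iter (boundary C) n (frag_of x)"
proof -
  have "finite (mu C n x k) \<and> neg_iter (boundary C) k (ind (mu C n x k)) = neg_iter (boundary C) n (frag_of x)"
    using assms(3)
  proof (induction k rule: inc_induct)
    case (step k)
    then show ?case
      using finite_mp[OF assms(1) _ assms(2)] frag_neg_bd_ind[OF assms(1) _ assms(2), symmetric]
      by (simp add: mu_less)
  qed simp
  then show ?thesis
    by simp
qed

lemma pos_iter_pi_sets:
  assumes "parity_structure C" "\<And>k. k \<le> n \<Longrightarrow> well_formed C k (pi_sets C n x k)" "k \<le> n"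
  shows "pos_iter (boundary C) k (ind (pi_sets C n x k)) = pos_iter (boundary C) n (frag_of x)"
proof -
  have "finite (pi_sets C n x k) \<and> pos_iter (boundary C) k (ind (pi_sets C n x k)) = pos_iter (boundary C) n (frag_of x)"
    using assms(3)
  proof (induction k rule: inc_induct)
    case (step k)
    then show ?case
      using finite_pm[OF assms(1) _ assms(2)] frag_pos_bd_ind[OF assms(1) _ assms(2), symmetric]
      by (simp add: pi_sets_less)
  qed simp
  then show ?thesis
    by simp
qed

text \<open>A chain is determined by its positive and negative parts. The two globular equations
  together therefore say that the indicators of the two boundaries of \<open>x\<close> have the same
  boundary.\<close>

lemma bd_ind_neg_eq_pos:
  assumes "parity_structure C" "x \<in> cells C (Suc (Suc n))"
    and "well_formed C (Suc n) (neg C (Suc n) x)" "well_formed C (Suc n) (pos C (Suc n) x)"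
  shows "frag_extend (boundary C n) (boundary C (Suc n) x) = 0 \<longleftrightarrow>
    mp C n (neg C (Suc n) x) = mp C n (pos C (Suc n) x) \<and>
    pm C n (neg C (Suc n) x) = pm C n (pos C (Suc n) x)"
proof -
  note p = parity_structureD(1,2)[OF assms(1,2)]
  let ?N = "frag_extend (boundary C n) (ind (neg C (Suc n) x))"
  let ?P = "frag_extend (boundary C n) (ind (pos C (Suc n) x))"
  note bd = frag_neg_bd_ind[OF assms(1) p(1) assms(3)] frag_pos_bd_ind[OF assms(1) p(1) assms(3)]
    frag_neg_bd_ind[OF assms(1) p(2) assms(4)] frag_pos_bd_ind[OF assms(1) p(2) assms(4)]
  note fin = finite_mp[OF assms(1) p(1) assms(3)] finite_pm[OF assms(1) p(1) assms(3)]
    finite_mp[OF assms(1) p(2) assms(4)] finite_pm[OF assms(1) p(2) assms(4)]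
  have "frag_extend (boundary C n) (boundary C (Suc n) x) = 0 \<longleftrightarrow> ?N = ?P"
    by (auto simp: boundary_def[of C "Suc n"] frag_extend_diff)
  also have "\<dots> \<longleftrightarrow> frag_neg ?N = frag_neg ?P \<and> frag_pos ?N = frag_pos ?P"
    using frag_pos_minus_neg[of ?N] frag_pos_minus_neg[of ?P] by metis
  also have "\<dots> \<longleftrightarrow> mp C n (neg C (Suc n) x) = mp C n (pos C (Suc n) x) \<and>
    pm C n (neg C (Suc n) x) = pm C n (pos C (Suc n) x)"
    unfolding bd using keys_ind fin by metis
  finally show ?thesis .
qed

lemma weakly_loop_free_iff:
  assumes "parity_structure C"
  shows "weakly_loop_free C \<longleftrightarrow> (\<forall>n. \<exists>r. partial_order_on (cells C (Suc n)) r \<and>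
    (\<forall>a \<in> cells C (Suc n). \<forall>b \<in> cells C (Suc n).
      (\<exists>c. lk (boundary C n a) c > 0 \<and> lk (boundary C n b) c < 0) \<longrightarrow> (a, b) \<in> r))"
proof -
  have "pos C n x \<inter> neg C n y \<noteq> {} \<longleftrightarrow> (\<exists>c. lk (boundary C n x) c > 0 \<and> lk (boundary C n y) c < 0)"
    if "x \<in> cells C (Suc n)" "y \<in> cells C (Suc n)" for n x y
    using lookup_boundary_pos[OF assms that(1)] lookup_boundary_neg[OF assms that(2)] by blast
  then show ?thesis
    unfolding weakly_loop_free_def by (simp cong: ball_cong)
qed

lemma (in steiner) well_formed_if_good:
  assumes C: "parity_structure C" "B = cells C" "d = boundary C" and x: "good B d n x"
  shows "well_formed C n (ky x)"
proof (cases n)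
  case 0
  then show ?thesis
    using x C(2) nonneg_coeff_sum_1[of x] by (auto simp: is_singleton_def) (metis keys_frag_of)
next
  case (Suc m)
  have "a = b" if "a \<in> ky x" "b \<in> ky x" "c \<in> neg C m a \<and> c \<in> neg C m b \<or> c \<in> pos C m a \<and> c \<in> pos C m b" for a b c
  proof -
    have "a \<in> cells C (Suc m)" "b \<in> cells C (Suc m)"
      using good_keys[OF x] that(1,2) Suc C(2) by auto
    then show ?thesis
      using that good_ind_eq[of n "ky x" a b m c] x Suc
      by (auto simp: good_ind[OF x] C(3) lookup_boundary_pos[OF C(1)] lookup_boundary_neg[OF C(1)] simp del: good.simps)
  qed
  then show ?thesis
    using good_keys[OF x] unfolding Suc C(2) by auto
qed

lemma weak_parity_complex_imp_steiner:
  assumes "weak_parity_complex C"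
  shows "steiner (cells C) (boundary C)"
proof -
  have C: "parity_structure C" and glob: "globular C" and un: "unital C" and wlf: "weakly_loop_free C"
    using assms unfolding weak_parity_complex_def by auto
  have wf: "well_formed C k (mu C n x k)" "well_formed C k (pi_sets C n x k)"
    if "x \<in> cells C n" "k \<le> n" for n k x
    using un that unfolding unital_def by auto
  \<comment> \<open>Unitality one degree below the top, where \<open>mu\<close> and
    \<open>pi_sets\<close> are the boundaries themselves.\<close>
  have wf': "well_formed C n (neg C n x)" "well_formed C n (pos C n x)" if "x \<in> cells C (Suc n)" for n x
    using wf[OF that, of n] by (simp_all add: mu_neg[OF C that] pi_sets_pos[OF C that])
  have t1: "coeff_sum (ind S) = 1" if "well_formed C 0 S" for S
    using that by (auto simp: is_singleton_def)
  show ?thesis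
  proof
    show "ky (boundary C n b) \<subseteq> cells C n" if "b \<in> cells C (Suc n)" for n b
      using C that by (rule keys_boundary)
    show "frag_extend (boundary C n) (boundary C (Suc n) b) = 0" if "b \<in> cells C (Suc (Suc n))" for n b
      using glob that wf'[OF that] bd_ind_neg_eq_pos[OF C that] unfolding globular_def by simp
    show "coeff_sum (boundary C 0 b) = 0" if "b \<in> cells C (Suc 0)" for b
      using t1[OF wf'(1)[OF that]] t1[OF wf'(2)[OF that]] by (simp add: boundary_def coeff_sum_diff)
    show "coeff_sum (neg_iter (boundary C) n (frag_of b)) = 1" if "b \<in> cells C n" for b n
      using neg_iter_mu[OF C wf(1)[OF that], of 0] t1[OF wf(1)[OF that, of 0]] by simp
    show "coeff_sum (pos_iter (boundary C) n (frag_of b)) = 1" if "b \<in> cells C n" for b n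
      using pos_iter_pi_sets[OF C wf(2)[OF that], of 0] t1[OF wf(2)[OF that, of 0]] by simp
  qed (use wlf weakly_loop_free_iff[OF C] in blast)
qed

lemma steiner_imp_weak_parity_complex:
  assumes C: "parity_structure C" and "steiner (cells C) (boundary C)"
  shows "weak_parity_complex C"
proof -
  interpret steiner "cells C" "boundary C"
    by fact
  have wf: "well_formed C n S" if "good (cells C) (boundary C) n (ind S)" "finite S" for n S
    using well_formed_if_good[OF C refl refl that(1)] that(2) by (simp add: keys_ind)
  have "globular C"
    unfolding globular_def
  proof (intro allI ballI)
    fix n x assume x: "x \<in> cells C (Suc (Suc n))"
    have "well_formed C (Suc n) (neg C (Suc n) x)" "well_formed C (Suc n) (pos C (Suc n) x)"
      using good_neg_d[OF x] good_pos_d[OF x] parity_structureD(1,2)[OF C x]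
      by (simp_all only: frag_neg_boundary[OF C x] frag_pos_boundary[OF C x] wf)
    then show "mp C n (neg C (Suc n) x) = mp C n (pos C (Suc n) x) \<and>
        pm C n (neg C (Suc n) x) = pm C n (pos C (Suc n) x)"
      using dd[OF x] bd_ind_neg_eq_pos[OF C x] by blast
  qed
  moreover have "unital C"
    unfolding unital_def
  proof (intro allI ballI impI)
    fix n x k assume x: "x \<in> cells C n" and k: "k \<le> n"
    \<comment> \<open>Well-formedness descends from the top. In degree \<open>Suc k\<close> it
      identifies the next set with the support of a negative boundary; the iterated augmentation of
      that chain is still that of \<open>x\<close>, namely 1, so the chain is good and its support
      well-formed.\<close>
    have "finite (mu C n x k) \<and> well_formed C k (mu C n x k)
        \<and> neg_iter (boundary C) k (ind (mu C n x k)) = neg_iter (boundary C) n (frag_of x)" (is ?mu)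
      using k
    proof (induction k rule: inc_induct)
      case base
      then show ?case
        using wf[of n "{x}"] good_frag_of[OF x] by simp
    next
      case (step k)
      let ?S = "mu C n x (Suc k)"
      have S: "finite ?S" "well_formed C (Suc k) ?S"
        using step.IH by auto
      note bd = frag_neg_bd_ind[OF C S]
      have "neg_iter (boundary C) k (ind (mp C k ?S)) = neg_iter (boundary C) n (frag_of x)"
        using step.IH bd by simp
      moreover have "good (cells C) (boundary C) k (ind (mp C k ?S))"
      proof (rule good_if_neg_iter)
        have "ky (ind ?S) \<subseteq> cells C (Suc k)"
          using S by (simp add: keys_ind)
        then show "ky (ind (mp C k ?S)) \<subseteq> cells C k"
          using keys_bd subset_trans[OF keys_frag_neg_subset] bd by metis
      qed (use calculation unital_neg[OF x] in simp_all)
      ultimately show ?case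
        using step.hyps wf finite_mp[OF C S] by (simp add: mu_less)
    qed
    moreover have "finite (pi_sets C n x k) \<and> well_formed C k (pi_sets C n x k)
        \<and> pos_iter (boundary C) k (ind (pi_sets C n x k)) = pos_iter (boundary C) n (frag_of x)"
      using k
    proof (induction k rule: inc_induct)
      case base
      then show ?case
        using wf[of n "{x}"] good_frag_of[OF x] by simp
    next
      case (step k)
      let ?S = "pi_sets C n x (Suc k)"
      have S: "finite ?S" "well_formed C (Suc k) ?S"
        using step.IH by auto
      note bd = frag_pos_bd_ind[OF C S]
      have "pos_iter (boundary C) k (ind (pm C k ?S)) = pos_iter (boundary C) n (frag_of x)"
        using step.IH bd by simp
      moreover have "good (cells C) (boundary C) k (ind (pm C k ?S))"
      proof (rule good_if_pos_iter)
        have "ky (ind ?S) \<subseteq> cells C (Suc k)"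
          using S by (simp add: keys_ind)
        then show "ky (ind (pm C k ?S)) \<subseteq> cells C k"
          using keys_bd subset_trans[OF keys_frag_pos_subset] bd by metis
      qed (use calculation unital_pos[OF x] in simp_all)
      ultimately show ?case
        using step.hyps wf finite_pm[OF C S] by (simp add: pi_sets_less)
    qed
    ultimately show "well_formed C k (mu C n x k) \<and> well_formed C k (pi_sets C n x k)"
      by blast
  qed
  moreover have "weakly_loop_free C"
    unfolding weakly_loop_free_iff[OF C] using loop_free by blast
  ultimately show ?thesis
    using C unfolding weak_parity_complex_def by blast
qed

section \<open>Reading a parity structure off a free complex\<close>

definition parity_of :: "(nat \<Rightarrow> 'a set) \<Rightarrow> (nat \<Rightarrow> 'a \<Rightarrow> 'a \<Rightarrow>\<^sub>0 int) \<Rightarrow> 'a parity" where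
  "parity_of B d = \<lparr>cells = B, neg = \<lambda>n x. ky (frag_neg (d n x)), pos = \<lambda>n x. ky (frag_pos (d n x))\<rparr>"

text \<open>Iterated boundaries stay supported in the basis, and only there are \<open>d\<close> and
  \<open>d'\<close> known to agree.\<close>

lemma neg_iter_cong:
  assumes "free_complex B d" "\<And>n b. b \<in> B (Suc n) \<Longrightarrow> d' n b = d n b"
  shows "ky x \<subseteq> B n \<Longrightarrow> neg_iter d' n x = neg_iter d n x"
proof (induction n arbitrary: x)
  case (Suc n)
  have "frag_extend (d' n) x = frag_extend (d n) x"
    using Suc.prems assms(2) by (intro frag_extend_eq) blast
  then show ?case
    using Suc.IH subset_trans[OF keys_frag_neg_subset free_complex.keys_bd[OF assms(1) Suc.prems]] by simp
qed simp

lemma pos_iter_cong: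
  assumes "free_complex B d" "\<And>n b. b \<in> B (Suc n) \<Longrightarrow> d' n b = d n b"
  shows "ky x \<subseteq> B n \<Longrightarrow> pos_iter d' n x = pos_iter d n x"
proof (induction n arbitrary: x)
  case (Suc n)
  have "frag_extend (d' n) x = frag_extend (d n) x"
    using Suc.prems assms(2) by (intro frag_extend_eq) blast
  then show ?case
    using Suc.IH subset_trans[OF keys_frag_pos_subset free_complex.keys_bd[OF assms(1) Suc.prems]] by simp
qed simp

context steiner
begin

text \<open>Passing to supports loses no coefficients here: both parts of the boundary of a basis
  element are good, hence equal to the indicators of their supports.\<close>

lemma boundary_parity_of: "b \<in> B (Suc n) \<Longrightarrow> boundary (parity_of B d) n b = d n b"
  by (simp add: boundary_def parity_of_def good_ind[OF good_neg_d] good_ind[OF good_pos_d] frag_pos_minus_neg)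

lemma steiner_parity_of: "steiner B (boundary (parity_of B d))"
proof -
  have fc: "free_complex B d"
    by unfold_locales
  show ?thesis
  proof
    show "frag_extend (boundary (parity_of B d) n) (boundary (parity_of B d) (Suc n) b) = 0"
      if "b \<in> B (Suc (Suc n))" for n b
    proof -
      have "frag_extend (boundary (parity_of B d) n) (d (Suc n) b) = frag_extend (d n) (d (Suc n) b)"
        using keys_d[OF that] by (intro frag_extend_eq boundary_parity_of) blast
      then show ?thesis
        using dd[OF that] boundary_parity_of[OF that] by simp
    qed
    show "\<exists>r. partial_order_on (B (Suc n)) r \<and> (\<forall>a\<in>B (Suc n). \<forall>b\<in>B (Suc n).
       (\<exists>c. 0 < lk (boundary (parity_of B d) n a) c \<and> lk (boundary (parity_of B d) n b) c < 0) \<longrightarrow> (a, b) \<in> r)" for n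
      using loop_free[of n] boundary_parity_of by (simp cong: ball_cong)
  qed (use boundary_parity_of keys_d coeff_sum_d unital_neg unital_pos neg_iter_cong[OF fc boundary_parity_of]
      pos_iter_cong[OF fc boundary_parity_of] in simp_all)
qed

lemma weak_parity_complex_parity_of: "weak_parity_complex (parity_of B d)"
proof (rule steiner_imp_weak_parity_complex)
  show "parity_structure (parity_of B d)"
    using subset_trans[OF keys_frag_neg_subset keys_d] subset_trans[OF keys_frag_pos_subset keys_d]
    unfolding parity_structure_def Fpow_def parity_of_def by (simp; auto simp: in_keys_iff)
qed (use steiner_parity_of in \<open>simp add: parity_of_def\<close>)

end

section \<open>Morphisms\<close>

text \<open>The matrix of a morphism of augmented directed complexes with respect to given bases:
  monotonicity becomes nonnegativity of the entries. Columns outside the basis are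
  unconstrained.\<close>

definition chain_hom ::
  "(nat \<Rightarrow> 'a set) \<Rightarrow> (nat \<Rightarrow> 'a \<Rightarrow> 'a \<Rightarrow>\<^sub>0 int) \<Rightarrow> (nat \<Rightarrow> 'a set) \<Rightarrow> (nat \<Rightarrow> 'a \<Rightarrow> 'a \<Rightarrow>\<^sub>0 int) \<Rightarrow>
   (nat \<Rightarrow> 'a \<Rightarrow> 'a \<Rightarrow>\<^sub>0 int) \<Rightarrow> bool" where
  "chain_hom B d B' d' f \<longleftrightarrow>
     (\<forall>n. \<forall>b \<in> B n. ky (f n b) \<subseteq> B' n \<and> nonneg (f n b)) \<and>
     (\<forall>b \<in> B 0. coeff_sum (f 0 b) = 1) \<and>
     (\<forall>n. \<forall>b \<in> B (Suc n). frag_extend (d' n) (f (Suc n) b) = frag_extend (f n) (d n b))"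

text \<open>The image of a source of \<open>x\<close> is a source of the image of \<open>x\<close>.
  Only commutation up to degree \<open>n\<close> is used, so the lemma is available while the chain
  map equations are still being proved degree by degree.\<close>

lemma (in free_complex) good_frag_extend:
  assumes "\<And>n b. b \<in> B n \<Longrightarrow> ky (f n b) \<subseteq> B' n \<and> nonneg (f n b)"
    and "\<And>b. b \<in> B 0 \<Longrightarrow> coeff_sum (f 0 b) = 1"
  shows "\<lbrakk>good B d n x; \<And>m b. \<lbrakk>m < n; b \<in> B (Suc m)\<rbrakk> \<Longrightarrow>
      frag_extend (d' m) (f (Suc m) b) = frag_extend (f m) (d m b)\<rbrakk>
    \<Longrightarrow> good B' d' n (frag_extend (f n) x)"
proof (induction n arbitrary: x)
  have keys: "ky (frag_extend (f n) x) \<subseteq> B' n" if "ky x \<subseteq> B n" for n x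
    using that assms(1) by (intro keys_frag_extend_subset) auto
  have nn: "nonneg (frag_extend (f n) x)" if "ky x \<subseteq> B n" "nonneg x" for n x
    using that assms(1) by (intro nonneg_frag_extend) auto
  {
    case 0
    then show ?case
      using keys[of x 0] nn[of x 0] assms(2) coeff_sum_frag_extend_1[of x "f 0"] by auto
  next
    case (Suc n)
    then obtain y where x: "nonneg x" "ky x \<subseteq> B (Suc n)"
      and y: "good B d n y" "nonneg (y + frag_extend (d n) x)"
      by auto
    have "frag_extend (d' n) (frag_extend (f (Suc n)) x) = frag_extend (f n) (frag_extend (d n) x)"
      unfolding frag_extend_extend using x(2) Suc.prems(2) by (intro frag_extend_eq) auto
    moreover have "nonneg (frag_extend (f n) (y + frag_extend (d n) x))"
      using good_add_bd[OF y(1) x(2) y(2)] by (intro nn) (auto dest: good_keys good_nonneg)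
    moreover have "good B' d' n (frag_extend (f n) y)"
      using Suc.prems(2) by (intro Suc.IH y) auto
    ultimately show ?case
      using x nn keys by (auto simp: frag_extend_add)
  }
qed

lemma chain_hom_good:
  "\<lbrakk>chain_hom B d B' d' f; free_complex B d; good B d n x\<rbrakk> \<Longrightarrow> good B' d' n (frag_extend (f n) x)"
  unfolding chain_hom_def by (rule free_complex.good_frag_extend) auto

lemma chain_hom_bd:
  "\<lbrakk>chain_hom B d B' d' f; ky x \<subseteq> B (Suc n)\<rbrakk>
    \<Longrightarrow> frag_extend (d' n) (frag_extend (f (Suc n)) x) = frag_extend (f n) (frag_extend (d n) x)"
  unfolding frag_extend_extend chain_hom_def by (intro frag_extend_eq) auto

lemma chain_hom_keys: "\<lbrakk>chain_hom B d B' d' f; ky x \<subseteq> B n\<rbrakk> \<Longrightarrow> ky (frag_extend (f n) x) \<subseteq> B' n"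
  unfolding chain_hom_def by (rule keys_frag_extend_subset) auto

lemma chain_hom_nonneg: "\<lbrakk>chain_hom B d B' d' f; ky x \<subseteq> B n; nonneg x\<rbrakk> \<Longrightarrow> nonneg (frag_extend (f n) x)"
  unfolding chain_hom_def by (rule nonneg_frag_extend) auto

lemma chain_hom_coeff_sum: "\<lbrakk>chain_hom B d B' d' f; ky x \<subseteq> B 0\<rbrakk> \<Longrightarrow> coeff_sum (frag_extend (f 0) x) = coeff_sum x"
  unfolding chain_hom_def by (rule coeff_sum_frag_extend_1) auto

lemma chain_hom_cong:
  assumes "free_complex B d" "\<And>n b. b \<in> B n \<Longrightarrow> f n b = g n b"
  shows "chain_hom B d B' d' f \<longleftrightarrow> chain_hom B d B' d' g"
proof -
  have "frag_extend (f n) (d n b) = frag_extend (g n) (d n b)" if "b \<in> B (Suc n)" for n b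
    using free_complex.keys_d[OF assms(1) that] assms(2) by (intro frag_extend_eq) blast
  then show ?thesis
    unfolding chain_hom_def using assms(2) by simp
qed

lemma chain_hom_comp:
  assumes "chain_hom B d B' d' f" "chain_hom B' d' B'' d'' g" "free_complex B d"
  shows "chain_hom B d B'' d'' (\<lambda>n b. frag_extend (g n) (f n b))"
  unfolding chain_hom_def
proof (intro conjI allI ballI)
  have f: "ky (f n b) \<subseteq> B' n" "nonneg (f n b)" if "b \<in> B n" for n b
    using assms(1) that unfolding chain_hom_def by auto
  show "ky (frag_extend (g n) (f n b)) \<subseteq> B'' n" "nonneg (frag_extend (g n) (f n b))" if "b \<in> B n" for n b
    using chain_hom_keys[OF assms(2)] chain_hom_nonneg[OF assms(2)] f[OF that] by auto
  show "coeff_sum (frag_extend (g 0) (f 0 b)) = 1" if "b \<in> B 0" for b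
    using chain_hom_coeff_sum[OF assms(2)] f[OF that] assms(1) that unfolding chain_hom_def by auto
  show "frag_extend (d'' n) (frag_extend (g (Suc n)) (f (Suc n) b)) =
      frag_extend (\<lambda>b. frag_extend (g n) (f n b)) (d n b)" if "b \<in> B (Suc n)" for n b
    using chain_hom_bd[OF assms(2)] f[OF that] assms(1) that
    unfolding chain_hom_def by (simp flip: frag_extend_extend)
qed

lemma chain_hom_frag_of: "chain_hom B d B d (\<lambda>n. frag_of)"
  unfolding chain_hom_def by (simp add: frag_expansion[symmetric])

lemma (in steiner) frag_extend_ind_good:
  assumes "good B d n (frag_extend (\<lambda>a. ind (f a)) (ind S))" "finite S" "\<And>a. a \<in> S \<Longrightarrow> finite (f a)"
  shows "frag_extend (\<lambda>a. ind (f a)) (ind S) = ind (\<Union>a\<in>S. f a)"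
  by (rule frag_extend_ind_Union) (use assms good_le_1 in auto)

text \<open>Two natural numbers have truncated differences, in both directions, that determine and
  are determined by their integer difference. The two multiset equations thus amount to one equation
  of chains.\<close>

lemma moves_iff:
  assumes "parity_structure D" "finite S" "S \<subseteq> cells D (Suc n)" "finite M" "finite P"
  shows "moves D n (mset_set S) (mset_set M) (mset_set P) \<longleftrightarrow>
    frag_extend (boundary D n) (ind S) = ind P - ind M"
proof -
  have fin: "finite (neg D n a)" "finite (pos D n a)" if "a \<in> S" for a
    using parity_structureD[OF assms(1), of a n] assms(3) that by auto
  have cnt: "int (count (mset_set A) c) = lk (ind A) c" if "finite A" for A and c :: 'a
    using that by (simp add: lookup_ind count_mset_set')
  have ph: "int (count (Phi_neg D n (mset_set S)) c) = (\<Sum>a\<in>S. lk (ind (neg D n a)) c)"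
    "int (count (Phi_pos D n (mset_set S)) c) = (\<Sum>a\<in>S. lk (ind (pos D n a)) c)" for c
    unfolding Phi_neg_def Phi_pos_def sum_unfold_sum_mset[symmetric] count_sum of_nat_sum
    by (auto intro: sum.cong cnt fin)
  have bd: "lk (frag_extend (boundary D n) (ind S)) c
      = int (count (Phi_pos D n (mset_set S)) c) - int (count (Phi_neg D n (mset_set S)) c)" for c
    by (simp add: frag_extend_ind[OF assms(2)] lookup_sum boundary_def lookup_minus sum_subtractf ph)
  have "moves D n (mset_set S) (mset_set M) (mset_set P) \<longleftrightarrow>
      (\<forall>c. count (Phi_neg D n (mset_set S)) c - count (Phi_pos D n (mset_set S)) c
          = count (mset_set M) c - count (mset_set P) c \<and>
        count (Phi_pos D n (mset_set S)) c - count (Phi_neg D n (mset_set S)) c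
          = count (mset_set P) c - count (mset_set M) c)"
    unfolding moves_def multiset_eq_iff by (auto simp del: count_mset_set)
  also have "\<dots> \<longleftrightarrow> (\<forall>c. lk (frag_extend (boundary D n) (ind S)) c = lk (ind P - ind M) c)"
    unfolding bd lookup_minus cnt[OF assms(4), symmetric] cnt[OF assms(5), symmetric]
    by (rule all_cong1) linarith
  finally show ?thesis
    by (auto intro: poly_mapping_eqI)
qed

lemma wpc_hom_iff:
  assumes "weak_parity_complex C" "weak_parity_complex D"
  shows "f \<in> wpc_hom C D \<longleftrightarrow> (\<forall>n. f n \<in> cells C n \<rightarrow>\<^sub>E Fpow (cells D n)) \<and>
    chain_hom (cells C) (boundary C) (cells D) (boundary D) (\<lambda>n x. ind (f n x))" (is "_ \<longleftrightarrow> ?F \<and> ?H")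
proof (cases ?F)
  case F: True
  have C: "parity_structure C" and D: "parity_structure D"
    using assms unfolding weak_parity_complex_def by auto
  interpret C: steiner "cells C" "boundary C"
    using assms(1) by (rule weak_parity_complex_imp_steiner)
  interpret D: steiner "cells D" "boundary D"
    using assms(2) by (rule weak_parity_complex_imp_steiner)
  have f: "finite (f n x)" "f n x \<subseteq> cells D n" if "x \<in> cells C n" for n x
    using F that unfolding Fpow_def by blast+
  then have keys_f: "ky (ind (f n x)) \<subseteq> cells D n \<and> nonneg (ind (f n x))" if "x \<in> cells C n" for n x
    using that by (simp add: keys_ind)
  \<comment> \<open>The chain map equation at a single cell, isolated to serve as the induction
    hypothesis in lower degrees.\<close>
  define bdf where "bdf n x \<longleftrightarrow> frag_extend (boundary D n) (ind (f (Suc n) x))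
    = frag_extend (\<lambda>x. ind (f n x)) (boundary C n x)" for n x
  \<comment> \<open>The equations in lower degrees make \<open>f\<close> send the good chains
    \<open>ind (neg C n x)\<close> and \<open>ind (pos C n x)\<close> to good chains, so the unions
    in the moving condition may be replaced by sums.\<close>
  have moves_f: "moves D n (mset_set (f (Suc n) x))
      (mset_set (\<Union>y \<in> neg C n x. f n y)) (mset_set (\<Union>y \<in> pos C n x. f n y)) \<longleftrightarrow> bdf n x"
    if "\<And>m b. \<lbrakk>m < n; b \<in> cells C (Suc m)\<rbrakk> \<Longrightarrow> bdf m b" "x \<in> cells C (Suc n)"
      "\<And>x. x \<in> cells C 0 \<Longrightarrow> coeff_sum (ind (f 0 x)) = 1" for n x
  proof -
    note p = parity_structureD[OF C that(2)]
    have fin: "finite (f n y)" if "y \<in> neg C n x \<or> y \<in> pos C n x" for y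
      using that f p(3,4) by blast
    have g: "good (cells D) (boundary D) n (frag_extend (\<lambda>x. ind (f n x)) z)" if "good (cells C) (boundary C) n z" for z
      using C.good_frag_extend[where f = "\<lambda>n x. ind (f n x)", OF keys_f \<open>\<And>x. x \<in> cells C 0 \<Longrightarrow> coeff_sum (ind (f 0 x)) = 1\<close> that]
        \<open>\<And>m b. \<lbrakk>m < n; b \<in> cells C (Suc m)\<rbrakk> \<Longrightarrow> bdf m b\<close> unfolding bdf_def by blast
    have "frag_extend (\<lambda>x. ind (f n x)) (ind (neg C n x)) = ind (\<Union>y \<in> neg C n x. f n y)"
      using C.good_neg_d[OF that(2)] g p fin
      by (intro D.frag_extend_ind_good) (auto simp: frag_neg_boundary[OF C that(2)])
    moreover have "frag_extend (\<lambda>x. ind (f n x)) (ind (pos C n x)) = ind (\<Union>y \<in> pos C n x. f n y)"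
      using C.good_pos_d[OF that(2)] g p fin
      by (intro D.frag_extend_ind_good) (auto simp: frag_pos_boundary[OF C that(2)])
    ultimately show ?thesis
      using f[OF that(2)] p fin
      by (subst moves_iff[OF D]) (auto simp: bdf_def boundary_def[of C] frag_extend_diff)
  qed
  show ?thesis
  proof
    assume "f \<in> wpc_hom C D"
    then have wf: "\<And>n x. x \<in> cells C n \<Longrightarrow> well_formed D n (f n x)"
      and mv: "\<And>n x. x \<in> cells C (Suc n) \<Longrightarrow> moves D n (mset_set (f (Suc n) x))
        (mset_set (\<Union>y \<in> neg C n x. f n y)) (mset_set (\<Union>y \<in> pos C n x. f n y))"
      unfolding wpc_hom_def by auto
    have t1: "coeff_sum (ind (f 0 x)) = 1" if "x \<in> cells C 0" for x
      using wf[OF that] by (auto simp: is_singleton_def)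
    have "\<forall>x\<in>cells C (Suc n). bdf n x" for n
      by (induction n rule: less_induct) (use moves_f mv t1 in blast)
    then show "?F \<and> ?H"
      using F keys_f t1 unfolding chain_hom_def bdf_def by simp
  next
    assume H: "?F \<and> ?H"
    then have bdf: "\<And>n x. x \<in> cells C (Suc n) \<Longrightarrow> bdf n x"
      and t1: "\<And>x. x \<in> cells C 0 \<Longrightarrow> coeff_sum (ind (f 0 x)) = 1"
      unfolding chain_hom_def bdf_def by auto
    \<comment> \<open>Well-formedness is a consequence of the chain map equations: a cell is a good
      chain, and so is its image.\<close>
    have "well_formed D n (f n x)" if "x \<in> cells C n" for n x
    proof -
      have "good (cells D) (boundary D) n (ind (f n x))"
        using chain_hom_good[OF conjunct2[OF H] C.free_complex_axioms C.good_frag_of[OF that]] by simp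
      then show ?thesis
        using D.well_formed_if_good[OF D refl refl] f[OF that] by (metis keys_ind)
    qed
    then show "f \<in> wpc_hom C D"
      using F moves_f bdf t1 unfolding wpc_hom_def by blast
  qed
next
  case False
  then show ?thesis
    unfolding wpc_hom_def by blast
qed

section \<open>The category of weak parity complexes\<close>

lemma wpc_hom_cells: "\<lbrakk>f \<in> wpc_hom C D; x \<in> cells C n\<rbrakk> \<Longrightarrow> f n x \<subseteq> cells D n \<and> finite (f n x)"
  unfolding wpc_hom_def Fpow_def by blast

lemma wpc_hom_undefined: "\<lbrakk>f \<in> wpc_hom C D; x \<notin> cells C n\<rbrakk> \<Longrightarrow> f n x = undefined"
  unfolding wpc_hom_def by (auto intro: PiE_arb)

text \<open>The image of a cell under two successive morphisms is a good chain. Composition by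
  unions is therefore multiplication of matrices.\<close>

lemma ind_Union_wpc_hom:
  assumes "weak_parity_complex C" "weak_parity_complex D" "weak_parity_complex E"
    and "f \<in> wpc_hom C D" "g \<in> wpc_hom D E" "x \<in> cells C n"
  shows "ind (\<Union>y \<in> f n x. g n y) = frag_extend (\<lambda>y. ind (g n y)) (ind (f n x))"
proof -
  interpret C: steiner "cells C" "boundary C"
    using assms(1) by (rule weak_parity_complex_imp_steiner)
  interpret D: steiner "cells D" "boundary D"
    using assms(2) by (rule weak_parity_complex_imp_steiner)
  interpret E: steiner "cells E" "boundary E"
    using assms(3) by (rule weak_parity_complex_imp_steiner)
  have f: "chain_hom (cells C) (boundary C) (cells D) (boundary D) (\<lambda>n x. ind (f n x))"
    using assms wpc_hom_iff by blast
  have g: "chain_hom (cells D) (boundary D) (cells E) (boundary E) (\<lambda>n x. ind (g n x))"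
    using assms wpc_hom_iff by blast
  have "good (cells E) (boundary E) n (frag_extend (\<lambda>y. ind (g n y)) (ind (f n x)))"
    using chain_hom_good[OF g D.free_complex_axioms
        chain_hom_good[OF f C.free_complex_axioms C.good_frag_of[OF assms(6)]]] by simp
  then show ?thesis
    using wpc_hom_cells[OF assms(4,6)] wpc_hom_cells[OF assms(5)] E.frag_extend_ind_good by fastforce
qed

lemma wpc_hom_comp:
  assumes "weak_parity_complex C" "weak_parity_complex D" "weak_parity_complex E"
    and "f \<in> wpc_hom C D" "g \<in> wpc_hom D E"
  shows "(\<lambda>n. \<lambda>x \<in> cells C n. \<Union>y \<in> f n x. g n y) \<in> wpc_hom C E" (is "?h \<in> _")
proof -
  have C: "free_complex (cells C) (boundary C)"
    using weak_parity_complex_imp_steiner[OF assms(1)] unfolding steiner_def by blast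
  have "?h n \<in> cells C n \<rightarrow>\<^sub>E Fpow (cells E n)" for n
  proof -
    have "y \<in> cells D n" "finite (f n x)" if "x \<in> cells C n" "y \<in> f n x" for x y
      using wpc_hom_cells[OF assms(4) that(1)] that(2) by auto
    then show ?thesis
      using wpc_hom_cells[OF assms(4)] wpc_hom_cells[OF assms(5)] unfolding Fpow_def by fastforce
  qed
  moreover have "chain_hom (cells C) (boundary C) (cells E) (boundary E) (\<lambda>n x. ind (?h n x))"
  proof -
    have "chain_hom (cells C) (boundary C) (cells E) (boundary E) (\<lambda>n x. frag_extend (\<lambda>y. ind (g n y)) (ind (f n x)))"
      using assms wpc_hom_iff C by (intro chain_hom_comp) blast+
    then show ?thesis
      using ind_Union_wpc_hom[OF assms]
      by (subst chain_hom_cong[OF C, of _ "\<lambda>n x. frag_extend (\<lambda>y. ind (g n y)) (ind (f n x))"]) auto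
  qed
  ultimately show ?thesis
    using wpc_hom_iff[OF assms(1,3)] by blast
qed

lemma is_category_WPC: "is_category WPC"
  unfolding is_category_def WPC_def
proof (simp, intro conjI allI ballI impI, goal_cases)
  case (1 C)
  have C: "free_complex (cells C) (boundary C)"
    using weak_parity_complex_imp_steiner[OF 1] unfolding steiner_def by blast
  show ?case
    unfolding wpc_hom_iff[OF 1 1]
    by (subst chain_hom_cong[OF C, of _ "\<lambda>n. frag_of"])
      (auto simp: chain_hom_frag_of Fpow_def)
next
  case (2 C D E f g)
  then show ?case
    by (rule wpc_hom_comp)
next
  case (3 C D f)
  then show ?case
    by (intro ext) (auto simp: wpc_hom_undefined)
next
  case (4 C D f)
  have "(\<Union>y\<in>f n x. (\<lambda>x\<in>cells D n. {x}) y) = f n x" if "x \<in> cells C n" for n x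
    using wpc_hom_cells[OF 4(3) that] by auto
  then show ?case
    using 4 by (intro ext) (auto simp: wpc_hom_undefined)
next
  case (5 W X Y Z f g h)
  have "(\<Union>y\<in>f n x. (\<lambda>x\<in>cells X n. \<Union> (h n ` g n x)) y) = (\<Union>y\<in>f n x. \<Union> (h n ` g n y))"
    if "x \<in> cells W n" for n x
    using wpc_hom_cells[OF 5(5) that] by (intro SUP_cong) auto
  then show ?case
    by (intro ext) simp
qed

section \<open>Preordered groups with a basis\<close>

lemma frag_hom_eq:
  assumes "f \<in> hom (free_Abelian_group S) G" "g \<in> hom (free_Abelian_group S) G" "group G"
    and "\<And>b. b \<in> S \<Longrightarrow> f (frag_of b) = g (frag_of b)" and "ky x \<subseteq> S"
  shows "f x = g x"
proof -
  interpret f: group_hom "free_Abelian_group S" G f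
    using assms(1,3) by (simp add: group_hom_def group_hom_axioms_def)
  interpret g: group_hom "free_Abelian_group S" G g
    using assms(2,3) by (simp add: group_hom_def group_hom_axioms_def)
  show ?thesis
    using assms(5)
  proof (induction x rule: free_Abelian_group_induct[consumes 1, case_names zero diff one])
    case zero
    then show ?case
      using f.hom_one g.hom_one by simp
  next
    case (diff x y)
    then show ?case
      using f.hom_mult[of x "- y"] g.hom_mult[of x "- y"] f.hom_inv[of y] g.hom_inv[of y] by simp
  next
    case (one b)
    then show ?case
      by (rule assms(4))
  qed
qed

lemma frag_extend_hom:
  "(\<And>a. a \<in> S \<Longrightarrow> ky (f a) \<subseteq> T) \<Longrightarrow> frag_extend f \<in> hom (free_Abelian_group S) (free_Abelian_group T)"
  by (rule homI) (simp_all add: frag_extend_add keys_frag_extend_subset[of _ S])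

text \<open>Two formal sums and their total have different supports; a common finite index set makes
  their combinations comparable.\<close>

lemma int_lincomb_superset:
  assumes "comm_group A" "finite T" "T \<subseteq> carrier A" "ky c \<subseteq> T"
  shows "int_lincomb A c = finprod A (\<lambda>b. b [^]\<^bsub>A\<^esub> lk c b) T"
proof -
  interpret comm_group A by fact
  show ?thesis
    unfolding int_lincomb_def
    by (rule finprod_mono_neutral_cong_left) (use assms in \<open>auto simp: in_keys_iff\<close>)
qed

lemma int_lincomb_hom:
  assumes "comm_group A" "B \<subseteq> carrier A"
  shows "int_lincomb A \<in> hom (free_Abelian_group B) A"
proof (rule homI)
  interpret comm_group A by fact
  show "int_lincomb A x \<in> carrier A" if "x \<in> carrier (free_Abelian_group B)" for x
    unfolding int_lincomb_def using that assms(2) by (intro finprod_closed) auto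
  show "int_lincomb A (x \<otimes>\<^bsub>free_Abelian_group B\<^esub> y) = int_lincomb A x \<otimes>\<^bsub>A\<^esub> int_lincomb A y"
    if "x \<in> carrier (free_Abelian_group B)" "y \<in> carrier (free_Abelian_group B)" for x y
  proof -
    let ?T = "ky x \<union> ky y"
    have T: "?T \<subseteq> carrier A"
      using that assms(2) by auto
    have "finprod A (\<lambda>b. b [^]\<^bsub>A\<^esub> lk (x + y) b) ?T
        = finprod A (\<lambda>b. b [^]\<^bsub>A\<^esub> lk x b \<otimes>\<^bsub>A\<^esub> b [^]\<^bsub>A\<^esub> lk y b) ?T"
      using T by (intro finprod_cong) (auto simp: lookup_add int_pow_mult simp_implies_def)
    also have "\<dots> = finprod A (\<lambda>b. b [^]\<^bsub>A\<^esub> lk x b) ?T \<otimes>\<^bsub>A\<^esub> finprod A (\<lambda>b. b [^]\<^bsub>A\<^esub> lk y b) ?T"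
      using T by (intro finprod_multf) auto
    finally show ?thesis
      using T keys_add[of x y] int_lincomb_superset[OF assms(1) _ T] by simp
  qed
qed

lemma int_lincomb_frag_of: "comm_group A \<Longrightarrow> b \<in> carrier A \<Longrightarrow> int_lincomb A (frag_of b) = b"
proof -
  assume "comm_group A" and b: "b \<in> carrier A"
  then interpret comm_group A by simp
  show ?thesis
    using b by (simp add: int_lincomb_def)
qed

lemma lookup_map_int [simp]: "lk (Poly_Mapping.map int c) b = int (lk c b)"
  by (simp add: Poly_Mapping.map.rep_eq when_def)

lemma keys_map_int [simp]: "ky (Poly_Mapping.map int c) = ky c"
  by (auto simp: in_keys_iff)

lemma inj_map_int: "inj (Poly_Mapping.map int)"
  by (rule injI, rule poly_mapping_eqI) (metis lookup_map_int of_nat_eq_iff)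

lemma image_map_int: "Poly_Mapping.map int ` {c. ky c \<subseteq> S} = {c. ky c \<subseteq> S \<and> nonneg c}"
proof (intro equalityI subsetI)
  fix c assume c: "c \<in> {c. ky c \<subseteq> S \<and> nonneg c}"
  have "Poly_Mapping.map int (Poly_Mapping.map nat c) = c"
  proof (rule poly_mapping_eqI)
    fix b
    have "0 \<le> lk c b"
      using c by (simp add: nonneg_def)
    then show "lk (Poly_Mapping.map int (Poly_Mapping.map nat c)) b = lk c b"
      by (simp add: Poly_Mapping.map.rep_eq when_def)
  qed
  moreover have "ky (Poly_Mapping.map nat c) \<subseteq> ky c"
    by (auto simp: in_keys_iff Poly_Mapping.map.rep_eq when_def)
  ultimately show "c \<in> Poly_Mapping.map int ` {c. ky c \<subseteq> S}"
    using c by (intro image_eqI[of _ _ "Poly_Mapping.map nat c"]) auto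
qed (auto simp: nonneg_def)

lemma nat_lincomb_eq: "nat_lincomb A c = int_lincomb A (Poly_Mapping.map int c)"
  by (simp add: nat_lincomb_def int_lincomb_def int_pow_int)

text \<open>Combinations with natural coefficients are the nonnegative integer ones, so uniqueness
  over the naturals is inherited from the integers. What remains of the condition on the monoid is
  that these combinations fill exactly the cone.\<close>

lemma is_basis_iff:
  "is_basis A B \<longleftrightarrow> B \<subseteq> cone A \<and> bij_betw (int_lincomb A) {c. ky c \<subseteq> B} (carrier A)
    \<and> int_lincomb A ` {c. ky c \<subseteq> B \<and> nonneg c} = cone A"
proof -
  have img: "nat_lincomb A ` {c. ky c \<subseteq> B} = int_lincomb A ` {c. ky c \<subseteq> B \<and> nonneg c}"
    unfolding image_map_int[symmetric] image_image nat_lincomb_eq ..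
  have "inj_on (nat_lincomb A) {c. ky c \<subseteq> B}" if "inj_on (int_lincomb A) {c. ky c \<subseteq> B}"
  proof (rule inj_onI)
    fix c c' assume "c \<in> {c. ky c \<subseteq> B}" "c' \<in> {c. ky c \<subseteq> B}" "nat_lincomb A c = nat_lincomb A c'"
    then have "Poly_Mapping.map int c = Poly_Mapping.map int c'"
      by (intro inj_onD[OF that]) (auto simp: nat_lincomb_eq)
    then show "c = c'"
      using inj_map_int by (rule injD[rotated])
  qed
  then show ?thesis
    unfolding is_basis_def bij_betw_def img by blast
qed

text \<open>\<open>\<phi>\<close> covers two situations: evaluation of linear combinations, where
  the labels in \<open>B\<close> are themselves elements of the group, and an encoding of formal
  sums, where they merely name the elements \<open>\<phi> (frag_of b)\<close>.\<close>

locale free_pgroup =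
  fixes A :: "'u pgroup" and B :: "'b set" and \<phi> :: "('b \<Rightarrow>\<^sub>0 int) \<Rightarrow> 'u"
  assumes comm: "comm_group A"
    and iso: "\<phi> \<in> iso (free_Abelian_group B) A"
    and leq: "leq A = {(\<phi> x, \<phi> y) | x y. ky x \<subseteq> B \<and> ky y \<subseteq> B \<and> nonneg (y - x)}"
begin

sublocale comm_group A
  by (rule comm)

lemma phi_hom: "\<phi> \<in> hom (free_Abelian_group B) A"
  using iso by (simp add: iso_def)

lemma bij: "bij_betw \<phi> {x. ky x \<subseteq> B} (carrier A)"
proof -
  have "{x. ky x \<subseteq> B} = carrier (free_Abelian_group B)"
    by auto
  then show ?thesis
    using iso by (simp add: iso_def)
qed

lemma carrier_eq: "carrier A = \<phi> ` {x. ky x \<subseteq> B}"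
  using bij by (simp add: bij_betw_def)

lemma phi_closed [simp]: "ky x \<subseteq> B \<Longrightarrow> \<phi> x \<in> carrier A"
  by (auto simp: carrier_eq)

lemma phi_cases:
  assumes "a \<in> carrier A"
  obtains x where "ky x \<subseteq> B" "a = \<phi> x"
  using assms by (auto simp: carrier_eq)

lemma phi_eq_iff: "\<lbrakk>ky x \<subseteq> B; ky y \<subseteq> B\<rbrakk> \<Longrightarrow> \<phi> x = \<phi> y \<longleftrightarrow> x = y"
  using iso by (auto simp: iso_def bij_betw_def inj_on_def)

lemma phi_add: "\<lbrakk>ky x \<subseteq> B; ky y \<subseteq> B\<rbrakk> \<Longrightarrow> \<phi> (x + y) = \<phi> x \<otimes>\<^bsub>A\<^esub> \<phi> y"
  using hom_mult[OF phi_hom] by simp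

lemma phi_0: "\<phi> 0 = \<one>\<^bsub>A\<^esub>"
  using hom_one[OF phi_hom group_free_Abelian_group is_group] by simp

lemma phi_minus:
  assumes "ky x \<subseteq> B"
  shows "\<phi> (- x) = inv\<^bsub>A\<^esub> \<phi> x"
proof -
  have "\<phi> (- x) \<otimes>\<^bsub>A\<^esub> \<phi> x = \<one>\<^bsub>A\<^esub>"
    using assms phi_add[of "- x" x] by (simp add: phi_0)
  then show ?thesis
    using assms by (intro inv_equality[symmetric]) simp_all
qed

lemma leq_phi: "\<lbrakk>ky x \<subseteq> B; ky y \<subseteq> B\<rbrakk> \<Longrightarrow> (\<phi> x, \<phi> y) \<in> leq A \<longleftrightarrow> nonneg (y - x)"
  by (auto simp: leq phi_eq_iff)

lemma preordered: "preordered_abelian_group A"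
  unfolding preordered_abelian_group_def
proof (intro conjI ballI impI)
  show "preorder_on (carrier A) (leq A)"
    unfolding preorder_on_def
  proof (intro conjI)
    show "leq A \<subseteq> carrier A \<times> carrier A"
      by (auto simp: leq)
    show "refl_on (carrier A) (leq A)"
      by (auto simp: refl_on_def leq_phi elim!: phi_cases)
    show "trans (leq A)"
    proof (rule transI)
      fix a b c assume "(a, b) \<in> leq A" "(b, c) \<in> leq A"
      then obtain x y y' z where *: "a = \<phi> x" "b = \<phi> y" "b = \<phi> y'" "c = \<phi> z" "nonneg (y - x)" "nonneg (z - y')"
        "ky x \<subseteq> B" "ky y \<subseteq> B" "ky y' \<subseteq> B" "ky z \<subseteq> B"
        unfolding leq by blast
      then have "y' = y"
        using phi_eq_iff by metis
      moreover have "0 \<le> lk z b - lk x b" if "nonneg (y - x)" "nonneg (z - y)" for b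
        using that[unfolded nonneg_def lookup_minus, THEN spec[of _ b]] by simp
      ultimately show "(a, c) \<in> leq A"
        using * by (simp add: leq_phi) (simp add: nonneg_def lookup_minus)
    qed
  qed
  show "(a \<otimes>\<^bsub>A\<^esub> c, b \<otimes>\<^bsub>A\<^esub> c) \<in> leq A"
    if abc: "a \<in> carrier A" "b \<in> carrier A" "c \<in> carrier A" and ab: "(a, b) \<in> leq A" for a b c
  proof -
    obtain x y z where x: "ky x \<subseteq> B" "a = \<phi> x" and y: "ky y \<subseteq> B" "b = \<phi> y" and z: "ky z \<subseteq> B" "c = \<phi> z"
      using abc by (metis phi_cases)
    have "ky (x + z) \<subseteq> B" "ky (y + z) \<subseteq> B"
      using x y z keys_add[of x z] keys_add[of y z] by auto
    then show ?thesis
      using x y z ab leq_phi[of "x + z" "y + z"] leq_phi[of x y] by (simp add: phi_add)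
  qed
qed (rule comm)

lemma cone_eq: "cone A = \<phi> ` {x. ky x \<subseteq> B \<and> nonneg x}"
  using leq_phi[of 0] unfolding cone_def carrier_eq phi_0[symmetric] by auto

lemma phi_in_cone: "ky x \<subseteq> B \<Longrightarrow> \<phi> x \<in> cone A \<longleftrightarrow> nonneg x"
  using leq_phi[of 0 x] by (simp add: cone_def phi_0)

lemma is_meet_phi:
  assumes "ky x \<subseteq> B" "ky y \<subseteq> B"
  shows "is_meet A (\<phi> x) (\<phi> y) \<one>\<^bsub>A\<^esub> \<longleftrightarrow> nonneg x \<and> nonneg y \<and> (\<forall>c. lk x c = 0 \<or> lk y c = 0)"
    (is "?L \<longleftrightarrow> ?R")
proof
  assume L: ?L
  then have nn: "nonneg x" "nonneg y"
    using assms leq_phi[of 0] unfolding is_meet_def phi_0[symmetric] by auto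
  \<comment> \<open>The pointwise minimum of \<open>x\<close> and \<open>y\<close>. As a common
    lower bound it must lie below 0, which makes the supports disjoint.\<close>
  define l where "l = x - frag_pos (x - y)"
  have lk: "lk l c = min (lk x c) (lk y c)" for c
    by (simp add: l_def lookup_minus)
  have "ky l \<subseteq> ky x \<union> ky y"
    by (auto simp: in_keys_iff lk min_def split: if_splits)
  then have l: "ky l \<subseteq> B"
    using assms by blast
  have "nonneg (x - l)" "nonneg (y - l)"
    by (simp_all add: nonneg_def lookup_minus lk)
  then have "(\<phi> l, \<one>\<^bsub>A\<^esub>) \<in> leq A"
    using L assms l unfolding is_meet_def by (simp add: leq_phi)
  then have "nonneg (- l)"
    using leq_phi[OF l, of 0] by (simp add: phi_0)
  then have "min (lk x c) (lk y c) \<le> 0" for c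
    unfolding nonneg_def by (simp add: lk)
  then show ?R
    using nn unfolding nonneg_def by (metis min_def order.antisym)
next
  assume R: ?R
  show ?L
    unfolding is_meet_def
  proof (intro conjI ballI impI)
    show "(\<one>\<^bsub>A\<^esub>, \<phi> x) \<in> leq A" "(\<one>\<^bsub>A\<^esub>, \<phi> y) \<in> leq A"
      using R assms leq_phi[of 0] by (simp_all add: phi_0)
    fix a assume "a \<in> carrier A" and a: "(a, \<phi> x) \<in> leq A \<and> (a, \<phi> y) \<in> leq A"
    then obtain l where l: "ky l \<subseteq> B" "a = \<phi> l"
      by (metis phi_cases)
    then have le: "lk l c \<le> lk x c" "lk l c \<le> lk y c" for c
      using a assms by (simp_all add: leq_phi nonneg_def lookup_minus)
    have "lk l c \<le> 0" for c
      using le[of c] R by metis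
    then have "nonneg (- l)"
      by (simp add: nonneg_def)
    then show "(a, \<one>\<^bsub>A\<^esub>) \<in> leq A"
      using l leq_phi[of l 0] by (simp add: phi_0)
  qed
qed

text \<open>Existence and uniqueness at once, as the definite descriptions in
  \<open>pos_part\<close> and \<open>neg_part\<close> require.\<close>

lemma decomposes_phi:
  assumes x: "ky x \<subseteq> B"
  shows "decomposes A (\<phi> x) p q \<longleftrightarrow> p = \<phi> (frag_pos x) \<and> q = \<phi> (frag_neg x)"
proof
  note parts = subset_trans[OF keys_frag_pos_subset x] subset_trans[OF keys_frag_neg_subset x]
  {
    assume d: "decomposes A (\<phi> x) p q"
    then obtain y z where y: "ky y \<subseteq> B" "p = \<phi> y" and z: "ky z \<subseteq> B" "q = \<phi> z"
      unfolding decomposes_def cone_eq by blast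
    have yz: "nonneg y" "nonneg z" "\<forall>c. lk y c = 0 \<or> lk z c = 0"
      using d y z is_meet_phi by (auto simp: decomposes_def)
    have "\<phi> x = \<phi> (y - z)"
      using d y z phi_add[of y "- z"] by (simp add: decomposes_def phi_minus)
    moreover have "ky (y - z) \<subseteq> B"
      using y z keys_diff[of y z] by blast
    ultimately have "x = y - z"
      using x phi_eq_iff by blast
    then have "lk (frag_pos x) c = lk y c" "lk (frag_neg x) c = lk z c" for c
      using yz(1,2)[unfolded nonneg_def, THEN spec[of _ c]] yz(3)[THEN spec[of _ c]]
      by (auto simp: lookup_minus)
    then have "frag_pos x = y" "frag_neg x = z"
      by (auto intro!: poly_mapping_eqI simp del: lookup_frag_pos lookup_frag_neg)
    then show "p = \<phi> (frag_pos x) \<and> q = \<phi> (frag_neg x)"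
      using y z by simp
  next
    assume pq: "p = \<phi> (frag_pos x) \<and> q = \<phi> (frag_neg x)"
    have "\<phi> x = p \<otimes>\<^bsub>A\<^esub> inv\<^bsub>A\<^esub> q"
      using pq phi_add[OF parts(1), of "- frag_neg x"] parts
      by (simp add: phi_minus frag_pos_minus_neg)
    then show "decomposes A (\<phi> x) p q"
      using pq parts is_meet_phi[OF parts] by (auto simp: decomposes_def phi_in_cone)
  }
qed

lemma pos_part_phi: "ky x \<subseteq> B \<Longrightarrow> pos_part A (\<phi> x) = \<phi> (frag_pos x)"
  and neg_part_phi: "ky x \<subseteq> B \<Longrightarrow> neg_part A (\<phi> x) = \<phi> (frag_neg x)"
  by (simp_all add: pos_part_def neg_part_def decomposes_phi)

text \<open>On the image of \<open>B\<close>, linear combination is \<open>\<phi>\<close> preceded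
  by renaming basis elements back to their labels, and this renaming is bijective and respects
  nonnegativity in both directions.\<close>

lemma is_basis: "is_basis A ((\<lambda>b. \<phi> (frag_of b)) ` B)"
proof -
  define \<beta> where "\<beta> b = \<phi> (frag_of b)" for b
  define \<gamma> where "\<gamma> = inv_into B \<beta>"
  have "inj_on \<beta> B"
    by (auto simp: inj_on_def \<beta>_def phi_eq_iff frag_of_eq)
  then have \<gamma>\<beta>: "\<gamma> (\<beta> b) = b" if "b \<in> B" for b
    using that by (simp add: \<gamma>_def)
  let ?g = "frag_extend (\<lambda>b. frag_of (\<gamma> b))" and ?b = "frag_extend (\<lambda>b. frag_of (\<beta> b))"
  have \<gamma>: "\<gamma> b \<in> B" "\<beta> (\<gamma> b) = b" if "b \<in> \<beta> ` B" for b
    using that \<gamma>\<beta> by auto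
  have kg: "ky (?g x) \<subseteq> B" if "ky x \<subseteq> \<beta> ` B" for x
    using that \<gamma> by (intro keys_frag_extend_subset[of x "\<beta> ` B"]) auto
  have kb: "ky (?b x) \<subseteq> \<beta> ` B" if "ky x \<subseteq> B" for x
    using that by (intro keys_frag_extend_subset[of x B]) auto
  have bg: "?b (?g x) = x" if "ky x \<subseteq> \<beta> ` B" for x
    using that \<gamma> by (subst frag_extend_extend, intro frag_extend_frag_of) auto
  have gb: "?g (?b x) = x" if "ky x \<subseteq> B" for x
    using that \<gamma>\<beta> by (subst frag_extend_extend, intro frag_extend_frag_of) auto
  have sub: "\<beta> ` B \<subseteq> carrier A"
    by (auto simp: \<beta>_def)
  have il: "int_lincomb A x = \<phi> (?g x)" if "ky x \<subseteq> \<beta> ` B" for x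
  proof (rule frag_hom_eq[OF int_lincomb_hom[OF comm sub] _ is_group _ that])
    show "(\<lambda>x. \<phi> (?g x)) \<in> hom (free_Abelian_group (\<beta> ` B)) A"
      using Group.hom_compose[OF frag_extend_hom phi_hom, of "\<beta> ` B" "\<lambda>b. frag_of (\<gamma> b)"] \<gamma> by (auto simp: o_def)
    show "int_lincomb A (frag_of b) = \<phi> (?g (frag_of b))" if "b \<in> \<beta> ` B" for b
      using that \<gamma>(2)[OF that] int_lincomb_frag_of[OF comm, of b] sub by (auto simp: \<beta>_def)
  qed
  have "bij_betw ?g {x. ky x \<subseteq> \<beta> ` B} {x. ky x \<subseteq> B}"
  proof (rule bij_betw_byWitness[where f' = ?b])
    show "\<forall>x \<in> {x. ky x \<subseteq> \<beta> ` B}. ?b (?g x) = x" "\<forall>x \<in> {x. ky x \<subseteq> B}. ?g (?b x) = x"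
      using bg gb by blast+
    show "?g ` {x. ky x \<subseteq> \<beta> ` B} \<subseteq> {x. ky x \<subseteq> B}" "?b ` {x. ky x \<subseteq> B} \<subseteq> {x. ky x \<subseteq> \<beta> ` B}"
      using kg kb by blast+
  qed
  then have "bij_betw (\<lambda>x. \<phi> (?g x)) {x. ky x \<subseteq> \<beta> ` B} (carrier A)"
    using bij_betw_trans[OF _ bij, of ?g] by (simp add: o_def)
  then have il_bij: "bij_betw (int_lincomb A) {x. ky x \<subseteq> \<beta> ` B} (carrier A)"
    by (subst bij_betw_cong[OF il]) auto
  have "int_lincomb A ` {x. ky x \<subseteq> \<beta> ` B \<and> nonneg x} = (\<lambda>x. \<phi> (?g x)) ` {x. ky x \<subseteq> \<beta> ` B \<and> nonneg x}"
    using il by (intro image_cong) auto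
  also have "\<dots> = \<phi> ` {x. ky x \<subseteq> B \<and> nonneg x}"
  proof (intro equalityI subsetI)
    fix a assume "a \<in> (\<lambda>x. \<phi> (?g x)) ` {x. ky x \<subseteq> \<beta> ` B \<and> nonneg x}"
    then show "a \<in> \<phi> ` {x. ky x \<subseteq> B \<and> nonneg x}"
      using kg by (auto intro!: imageI nonneg_frag_extend)
  next
    fix a assume "a \<in> \<phi> ` {x. ky x \<subseteq> B \<and> nonneg x}"
    then obtain x where x: "ky x \<subseteq> B" "nonneg x" "a = \<phi> x"
      by blast
    then show "a \<in> (\<lambda>x. \<phi> (?g x)) ` {x. ky x \<subseteq> \<beta> ` B \<and> nonneg x}"
      using kb[of x] gb[of x] by (intro image_eqI[of _ _ "?b x"]) (auto intro!: nonneg_frag_extend)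
  qed
  finally have "int_lincomb A ` {x. ky x \<subseteq> \<beta> ` B \<and> nonneg x} = cone A"
    by (simp add: cone_eq)
  moreover have "\<beta> ` B \<subseteq> cone A"
    by (auto simp: \<beta>_def phi_in_cone)
  ultimately show ?thesis
    using il_bij unfolding is_basis_iff \<beta>_def by blast
qed

end

text \<open>By translation, \<open>a \<le> b\<close> means that the difference of \<open>b\<close>
  and \<open>a\<close> lies in the cone, which the basis identifies with the nonnegative formal
  sums. The given preorder is thus the pointwise order.\<close>

lemma free_pgroup_if_is_basis:
  assumes A: "preordered_abelian_group A" and B: "is_basis A B"
  shows "free_pgroup A B (int_lincomb A)"
proof (rule free_pgroup.intro)
  have comm: "comm_group A" and pre: "preorder_on (carrier A) (leq A)"
    and mono: "\<And>a b c. \<lbrakk>a \<in> carrier A; b \<in> carrier A; c \<in> carrier A; (a, b) \<in> leq A\<rbrakk>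
      \<Longrightarrow> (a \<otimes>\<^bsub>A\<^esub> c, b \<otimes>\<^bsub>A\<^esub> c) \<in> leq A"
    using A unfolding preordered_abelian_group_def by auto
  interpret comm_group A by fact
  let ?i = "int_lincomb A"
  show "comm_group A" by fact
  have B_sub: "B \<subseteq> carrier A" and bij: "bij_betw ?i {c. ky c \<subseteq> B} (carrier A)"
    and cone: "?i ` {c. ky c \<subseteq> B \<and> nonneg c} = cone A"
    using B by (simp_all add: is_basis_iff) (auto simp: cone_def)
  note hom = int_lincomb_hom[OF comm B_sub]
  have "{c. ky c \<subseteq> B} = carrier (free_Abelian_group B)"
    by auto
  then show iso: "?i \<in> iso (free_Abelian_group B) A"
    using hom bij by (simp add: iso_def)
  interpret i: group_hom "free_Abelian_group B" A ?i
    using hom is_group by (simp add: group_hom_def group_hom_axioms_def)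
  have le: "(?i x, ?i y) \<in> leq A \<longleftrightarrow> nonneg (y - x)" if x: "ky x \<subseteq> B" and y: "ky y \<subseteq> B" for x y
  proof -
    have yx: "ky (y - x) \<subseteq> B"
      using keys_diff[of y x] x y by blast
    have i: "?i x \<in> carrier A" "?i y \<in> carrier A"
      using x y by auto
    have "?i (y - x) = ?i y \<otimes>\<^bsub>A\<^esub> inv\<^bsub>A\<^esub> ?i x"
      using i.hom_mult[of y "- x"] i.hom_inv[of x] x y by simp
    moreover have "(?i x, ?i y) \<in> leq A \<longleftrightarrow> (\<one>\<^bsub>A\<^esub>, ?i y \<otimes>\<^bsub>A\<^esub> inv\<^bsub>A\<^esub> ?i x) \<in> leq A"
    proof
      show "(\<one>\<^bsub>A\<^esub>, ?i y \<otimes>\<^bsub>A\<^esub> inv\<^bsub>A\<^esub> ?i x) \<in> leq A" if "(?i x, ?i y) \<in> leq A"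
        using mono[OF i inv_closed[OF i(1)] that] i by simp
      show "(?i x, ?i y) \<in> leq A" if "(\<one>\<^bsub>A\<^esub>, ?i y \<otimes>\<^bsub>A\<^esub> inv\<^bsub>A\<^esub> ?i x) \<in> leq A"
        using mono[OF one_closed m_closed[OF i(2) inv_closed[OF i(1)]] i(1) that] i by (simp add: m_assoc)
    qed
    ultimately have "(?i x, ?i y) \<in> leq A \<longleftrightarrow> ?i (y - x) \<in> cone A"
      using i by (simp add: cone_def)
    also have "\<dots> \<longleftrightarrow> nonneg (y - x)"
    proof
      assume "?i (y - x) \<in> cone A"
      then obtain c where "ky c \<subseteq> B" "nonneg c" "?i (y - x) = ?i c"
        unfolding cone[symmetric] by blast
      then show "nonneg (y - x)"
        using inj_onD[OF bij_betw_imp_inj_on[OF bij]] yx by blast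
    next
      assume "nonneg (y - x)"
      then show "?i (y - x) \<in> cone A"
        unfolding cone[symmetric] using yx by blast
    qed
    finally show ?thesis .
  qed
  have "\<exists>x y. a = ?i x \<and> b = ?i y \<and> ky x \<subseteq> B \<and> ky y \<subseteq> B" if "(a, b) \<in> leq A" for a b
  proof -
    have "a \<in> ?i ` {c. ky c \<subseteq> B}" "b \<in> ?i ` {c. ky c \<subseteq> B}"
      using that pre bij unfolding preorder_on_def bij_betw_def by auto
    then show ?thesis
      by blast
  qed
  then show "leq A = {(?i x, ?i y) | x y. ky x \<subseteq> B \<and> ky y \<subseteq> B \<and> nonneg (y - x)}"
    using le by (auto; metis)
qed

section \<open>Augmented directed complexes with a basis\<close>

text \<open>Unitality and loop-freeness are left out, because they have to be translated in both
  directions between \<open>K\<close> and \<open>d\<close>.\<close>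

locale coordinates = free_complex B d
  for B :: "nat \<Rightarrow> 'b set" and d :: "nat \<Rightarrow> 'b \<Rightarrow> 'b \<Rightarrow>\<^sub>0 int" +
  fixes K :: "'u adcomplex" and \<phi> :: "nat \<Rightarrow> ('b \<Rightarrow>\<^sub>0 int) \<Rightarrow> 'u"
  assumes free_pgroup: "free_pgroup (grp K n) (B n) (\<phi> n)"
    and bd_phi: "ky x \<subseteq> B (Suc n) \<Longrightarrow> bd K n (\<phi> (Suc n) x) = \<phi> n (frag_extend (d n) x)"
    and aug_phi: "ky x \<subseteq> B 0 \<Longrightarrow> aug K (\<phi> 0 x) = coeff_sum x"
begin

sublocale A: free_pgroup "grp K n" "B n" "\<phi> n" for n
  by (rule free_pgroup)

lemma augmented_directed_complex: "augmented_directed_complex K"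
  unfolding augmented_directed_complex_def directed_chain_complex_def
proof (intro conjI allI ballI impI)
  show "preordered_abelian_group (grp K n)" for n
    by (rule A.preordered)
  have add: "ky (x + y) \<subseteq> B n" if "ky x \<subseteq> B n" "ky y \<subseteq> B n" for x y n
    using that keys_add[of x y] by blast
  show "bd K n \<in> hom (grp K (Suc n)) (grp K n)" for n
  proof (rule homI)
    fix a b assume "a \<in> carrier (grp K (Suc n))" "b \<in> carrier (grp K (Suc n))"
    then obtain x y where "ky x \<subseteq> B (Suc n)" "a = \<phi> (Suc n) x" "ky y \<subseteq> B (Suc n)" "b = \<phi> (Suc n) y"
      by (metis A.phi_cases)
    then show "bd K n a \<in> carrier (grp K n)"
      "bd K n (a \<otimes>\<^bsub>grp K (Suc n)\<^esub> b) = bd K n a \<otimes>\<^bsub>grp K n\<^esub> bd K n b"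
      by (simp_all add: bd_phi keys_bd frag_extend_add add flip: A.phi_add)
  qed
  show "bd K n (bd K (Suc n) a) = \<one>\<^bsub>grp K n\<^esub>" if "a \<in> carrier (grp K (Suc (Suc n)))" for n a
    using that by (rule A.phi_cases) (simp add: bd_phi keys_bd bd_bd A.phi_0)
  show "aug K \<in> hom (grp K 0) integer_group"
  proof (rule homI)
    fix a b assume "a \<in> carrier (grp K 0)" "b \<in> carrier (grp K 0)"
    then obtain x y where "ky x \<subseteq> B 0" "a = \<phi> 0 x" "ky y \<subseteq> B 0" "b = \<phi> 0 y"
      by (metis A.phi_cases)
    then show "aug K (a \<otimes>\<^bsub>grp K 0\<^esub> b) = aug K a \<otimes>\<^bsub>integer_group\<^esub> aug K b"
      by (simp add: aug_phi coeff_sum_add add flip: A.phi_add)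
  qed simp
  show "aug K a \<le> aug K b"
    if ab: "a \<in> carrier (grp K 0)" "b \<in> carrier (grp K 0)" "(a, b) \<in> leq (grp K 0)" for a b
  proof -
    obtain x y where "ky x \<subseteq> B 0" "a = \<phi> 0 x" "ky y \<subseteq> B 0" "b = \<phi> 0 y"
      using ab(1,2) by (metis A.phi_cases)
    then show ?thesis
      using ab(3) coeff_sum_nonneg[of "y - x"] by (simp add: aug_phi A.leq_phi coeff_sum_diff)
  qed
  show "aug K (bd K 0 a) = 0" if "a \<in> carrier (grp K 1)" for a
    using that unfolding One_nat_def by (rule A.phi_cases) (simp add: bd_phi aug_phi keys_bd coeff_sum_bd)
qed

lemma bd_neg_phi: "ky x \<subseteq> B (Suc n) \<Longrightarrow> bd_neg K n (\<phi> (Suc n) x) = \<phi> n (frag_neg (frag_extend (d n) x))"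
  and bd_pos_phi: "ky x \<subseteq> B (Suc n) \<Longrightarrow> bd_pos K n (\<phi> (Suc n) x) = \<phi> n (frag_pos (frag_extend (d n) x))"
  by (simp_all add: bd_neg_def bd_pos_def bd_phi A.neg_part_phi A.pos_part_phi keys_bd)

lemma aug_bd_neg_iter: "ky x \<subseteq> B n \<Longrightarrow> aug K (bd_neg_iter K n (\<phi> n x)) = coeff_sum (neg_iter d n x)"
proof (induction n arbitrary: x)
  case (Suc n)
  then show ?case
    using subset_trans[OF keys_frag_neg_subset keys_bd] by (simp add: bd_neg_phi)
qed (simp add: aug_phi)

lemma aug_bd_pos_iter: "ky x \<subseteq> B n \<Longrightarrow> aug K (bd_pos_iter K n (\<phi> n x)) = coeff_sum (pos_iter d n x)"
proof (induction n arbitrary: x)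
  case (Suc n)
  then show ?case
    using subset_trans[OF keys_frag_pos_subset keys_bd] by (simp add: bd_pos_phi)
qed (simp add: aug_phi)

lemma is_meet_bd_phi:
  assumes "b \<in> B (Suc n)" "c \<in> B (Suc n)"
  shows "is_meet (grp K n) (bd_pos K n (\<phi> (Suc n) (frag_of b))) (bd_neg K n (\<phi> (Suc n) (frag_of c))) \<one>\<^bsub>grp K n\<^esub>
    \<longleftrightarrow> \<not> (\<exists>e. lk (d n b) e > 0 \<and> lk (d n c) e < 0)"
proof -
  have k: "ky (frag_pos (d n b)) \<subseteq> B n" "ky (frag_neg (d n c)) \<subseteq> B n"
    using subset_trans[OF keys_frag_pos_subset keys_d[OF assms(1)]]
      subset_trans[OF keys_frag_neg_subset keys_d[OF assms(2)]] .
  have bd: "bd_pos K n (\<phi> (Suc n) (frag_of b)) = \<phi> n (frag_pos (d n b))"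
    "bd_neg K n (\<phi> (Suc n) (frag_of c)) = \<phi> n (frag_neg (d n c))"
    using assms bd_pos_phi[of "frag_of b" n] bd_neg_phi[of "frag_of c" n] by simp_all
  have "lk (frag_pos (d n b)) e = 0 \<or> lk (frag_neg (d n c)) e = 0 \<longleftrightarrow> \<not> (lk (d n b) e > 0 \<and> lk (d n c) e < 0)" for e
    unfolding lookup_frag_pos lookup_frag_neg by linarith
  then show ?thesis
    unfolding bd A.is_meet_phi[OF k] by simp
qed

lemma weak_steiner_complex_if_steiner:
  assumes "steiner B d"
  shows "weak_steiner_complex K"
proof -
  interpret steiner B d by fact
  let ?\<beta> = "\<lambda>n b. \<phi> n (frag_of b)"
  have eq: "?\<beta> n b = ?\<beta> n c \<longleftrightarrow> b = c" if "b \<in> B n" "c \<in> B n" for n b c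
    using that by (simp add: A.phi_eq_iff frag_of_eq)
  have "complex_basis K (\<lambda>n. ?\<beta> n ` B n)"
    unfolding complex_basis_def using A.is_basis by blast
  moreover have "unital_basis K (\<lambda>n. ?\<beta> n ` B n)"
    unfolding unital_basis_def using unital_neg unital_pos by (auto simp: aug_bd_neg_iter aug_bd_pos_iter)
  moreover have "weakly_loop_free_basis K (\<lambda>n. ?\<beta> n ` B n)"
    unfolding weakly_loop_free_basis_def
  proof
    fix n
    obtain r where r: "partial_order_on (B (Suc n)) r"
      and lf: "\<And>a b e. \<lbrakk>a \<in> B (Suc n); b \<in> B (Suc n); lk (d n a) e > 0; lk (d n b) e < 0\<rbrakk> \<Longrightarrow> (a, b) \<in> r"
      using loop_free[of n] by blast
    let ?b = "?\<beta> (Suc n)"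
    \<comment> \<open>The order carried from labels to group elements. Two pairs in
      \<open>?r\<close> meeting in an element may come with different labels for it, so transitivity
      and antisymmetry rest on the injectivity of \<open>?b\<close> on labels.\<close>
    let ?r = "{(?b a, ?b b) | a b. (a, b) \<in> r}"
    have r_sub: "a \<in> B (Suc n)" "b \<in> B (Suc n)" if "(a, b) \<in> r" for a b
      using r that unfolding partial_order_on_def preorder_on_def by auto
    have "partial_order_on (?b ` B (Suc n)) ?r"
      unfolding partial_order_on_def preorder_on_def
    proof (intro conjI)
      show "?r \<subseteq> ?b ` B (Suc n) \<times> ?b ` B (Suc n)"
        using r_sub by blast
      show "refl_on (?b ` B (Suc n)) ?r"
        using r unfolding partial_order_on_def preorder_on_def refl_on_def by blast
      show "trans ?r"
      proof (rule transI)
        fix x y z assume "(x, y) \<in> ?r" "(y, z) \<in> ?r"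
        then obtain a b b' c where *: "x = ?b a" "y = ?b b" "y = ?b b'" "z = ?b c" "(a, b) \<in> r" "(b', c) \<in> r"
          by blast
        then have "b = b'"
          using eq r_sub by metis
        then have "(a, c) \<in> r"
          using * r unfolding partial_order_on_def preorder_on_def trans_def by blast
        then show "(x, z) \<in> ?r"
          using * by blast
      qed
      show "antisym ?r"
      proof (rule antisymI)
        fix x y assume "(x, y) \<in> ?r" "(y, x) \<in> ?r"
        then obtain a b a' b' where *: "x = ?b a" "y = ?b b" "y = ?b b'" "x = ?b a'" "(a, b) \<in> r" "(b', a') \<in> r"
          by blast
        then have "b = b'" "a = a'"
          using eq r_sub by metis+
        then have "a = b"
          using * r unfolding partial_order_on_def antisym_def by blast
        then show "x = y"
          using * by simp
      qed
    qed
    moreover have "(x, y) \<in> ?r" if xy: "x \<in> ?b ` B (Suc n)" "y \<in> ?b ` B (Suc n)"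
      and "\<not> is_meet (grp K n) (bd_pos K n x) (bd_neg K n y) \<one>\<^bsub>grp K n\<^esub>" for x y
    proof -
      obtain a b where ab: "a \<in> B (Suc n)" "x = ?b a" "b \<in> B (Suc n)" "y = ?b b"
        using xy by blast
      then have "(a, b) \<in> r"
        using that(3) lf by (auto simp: is_meet_bd_phi)
      then show ?thesis
        using ab by blast
    qed
    ultimately show "\<exists>r. partial_order_on (?b ` B (Suc n)) r \<and> (\<forall>x \<in> ?b ` B (Suc n). \<forall>y \<in> ?b ` B (Suc n).
        \<not> is_meet (grp K n) (bd_pos K n x) (bd_neg K n y) \<one>\<^bsub>grp K n\<^esub> \<longrightarrow> (x, y) \<in> r)"
      by blast
  qed
  ultimately show ?thesis
    unfolding weak_steiner_complex_def using augmented_directed_complex by blast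
qed

end

text \<open>The elements of the basis serve as their own labels, with \<open>int_lincomb\<close> as
  \<open>\<phi>\<close> and the coordinates of \<open>bd K n b\<close> as
  \<open>d n b\<close>.\<close>

lemma weak_steiner_complex_coordinates:
  fixes K :: "'u adcomplex"
  assumes "weak_steiner_complex K"
  obtains B :: "nat \<Rightarrow> 'u set" and d \<phi> where "steiner B d" "coordinates B d K \<phi>"
proof -
  obtain B where K: "augmented_directed_complex K" and basis: "complex_basis K B"
    and un: "unital_basis K B" and wlf: "weakly_loop_free_basis K B"
    using assms unfolding weak_steiner_complex_def by blast
  have pre: "preordered_abelian_group (grp K n)" and bd_hom: "bd K n \<in> hom (grp K (Suc n)) (grp K n)"
    and bd_bd: "\<And>x. x \<in> carrier (grp K (Suc (Suc n))) \<Longrightarrow> bd K n (bd K (Suc n) x) = \<one>\<^bsub>grp K n\<^esub>" for n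
    using K unfolding augmented_directed_complex_def directed_chain_complex_def by auto
  have aug_hom: "aug K \<in> hom (grp K 0) integer_group"
    and aug_bd: "\<And>x. x \<in> carrier (grp K (Suc 0)) \<Longrightarrow> aug K (bd K 0 x) = 0"
    using K unfolding augmented_directed_complex_def by auto
  define \<phi> where "\<phi> n = int_lincomb (grp K n)" for n
  interpret A: free_pgroup "grp K n" "B n" "\<phi> n" for n
    unfolding \<phi>_def using basis pre by (intro free_pgroup_if_is_basis) (auto simp: complex_basis_def)
  have B_sub: "B n \<subseteq> carrier (grp K n)" for n
    using basis unfolding complex_basis_def is_basis_def cone_def by auto
  have phi_of: "\<phi> n (frag_of b) = b" if "b \<in> B n" for n b
    unfolding \<phi>_def using that B_sub A.comm by (intro int_lincomb_frag_of) auto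
  define d where "d n b = inv_into {x. ky x \<subseteq> B n} (\<phi> n) (bd K n b)" for n b
  have d: "ky (d n b) \<subseteq> B n" "\<phi> n (d n b) = bd K n b" if "b \<in> B (Suc n)" for n b
  proof -
    have *: "bd K n b \<in> \<phi> n ` {x. ky x \<subseteq> B n}"
      using hom_in_carrier[OF bd_hom subsetD[OF B_sub that]] unfolding A.carrier_eq .
    show "ky (d n b) \<subseteq> B n" "\<phi> n (d n b) = bd K n b"
      using inv_into_into[OF *] f_inv_into_f[OF *] by (simp_all add: d_def)
  qed
  have ext_d: "ky (frag_extend (d n) x) \<subseteq> B n" if "ky x \<subseteq> B (Suc n)" for n x
    using that d(1) by (rule keys_frag_extend_subset)
  have bd_phi: "bd K n (\<phi> (Suc n) x) = \<phi> n (frag_extend (d n) x)" if "ky x \<subseteq> B (Suc n)" for n x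
  proof (rule frag_hom_eq[OF _ _ A.is_group _ that])
    show "(\<lambda>x. bd K n (\<phi> (Suc n) x)) \<in> hom (free_Abelian_group (B (Suc n))) (grp K n)"
      using Group.hom_compose[OF A.phi_hom bd_hom] by (simp add: o_def)
    show "(\<lambda>x. \<phi> n (frag_extend (d n) x)) \<in> hom (free_Abelian_group (B (Suc n))) (grp K n)"
      using Group.hom_compose[OF frag_extend_hom[OF d(1)] A.phi_hom] by (simp add: o_def)
  qed (simp add: phi_of d)
  have aug_phi: "aug K (\<phi> 0 x) = coeff_sum x" if "ky x \<subseteq> B 0" for x
  proof (rule frag_hom_eq[OF _ _ group_integer_group _ that])
    show "(\<lambda>x. aug K (\<phi> 0 x)) \<in> hom (free_Abelian_group (B 0)) integer_group"
      using Group.hom_compose[OF A.phi_hom aug_hom] by (simp add: o_def)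
    show "coeff_sum \<in> hom (free_Abelian_group (B 0)) integer_group"
      by (rule homI) (auto simp: coeff_sum_add)
    \<comment> \<open>In degree 0 the iterated boundary is the element itself, so unitality gives it
      augmentation 1; this is why the augmentation becomes \<open>coeff_sum\<close>.\<close>
    show "aug K (\<phi> 0 (frag_of b)) = coeff_sum (frag_of b)" if "b \<in> B 0" for b
      using un[unfolded unital_basis_def, rule_format, OF that] that by (simp add: phi_of)
  qed
  interpret coordinates B d K \<phi>
  proof
    show "frag_extend (d n) (d (Suc n) b) = 0" if b: "b \<in> B (Suc (Suc n))" for n b
    proof -
      have "\<phi> n (frag_extend (d n) (d (Suc n) b)) = \<phi> n 0"
        using bd_phi[OF d(1)[OF b]] d(2)[OF b] bd_bd[of b n] b B_sub by (auto simp: A.phi_0)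
      then show ?thesis
        using ext_d[OF d(1)[OF b]] by (simp add: A.phi_eq_iff)
    qed
    show "coeff_sum (d 0 b) = 0" if "b \<in> B (Suc 0)" for b
      using aug_phi[OF d(1)[OF that]] d(2)[OF that] aug_bd[of b] that B_sub by auto
  qed (use d(1) bd_phi aug_phi A.free_pgroup_axioms in auto)
  have "steiner B d"
  proof
    show "coeff_sum (neg_iter d n (frag_of b)) = 1" if "b \<in> B n" for n b
      using aug_bd_neg_iter[of "frag_of b" n] un that unfolding unital_basis_def by (simp add: phi_of)
    show "coeff_sum (pos_iter d n (frag_of b)) = 1" if "b \<in> B n" for n b
      using aug_bd_pos_iter[of "frag_of b" n] un that unfolding unital_basis_def by (simp add: phi_of)
    show "\<exists>r. partial_order_on (B (Suc n)) r \<and> (\<forall>a\<in>B (Suc n). \<forall>b\<in>B (Suc n).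
        (\<exists>c. 0 < lk (d n a) c \<and> lk (d n b) c < 0) \<longrightarrow> (a, b) \<in> r)" for n
    proof -
      have "(\<exists>c. 0 < lk (d n a) c \<and> lk (d n b) c < 0) \<longleftrightarrow>
          \<not> is_meet (grp K n) (bd_pos K n a) (bd_neg K n b) \<one>\<^bsub>grp K n\<^esub>"
        if "a \<in> B (Suc n)" "b \<in> B (Suc n)" for a b
        using is_meet_bd_phi[OF that] phi_of[OF that(1)] phi_of[OF that(2)] by simp
      then show ?thesis
        using wlf[unfolded weakly_loop_free_basis_def, rule_format, of n] by (simp cong: ball_cong)
    qed
  qed
  then show thesis
    using that coordinates_axioms by blast
qed

text \<open>\<open>\<phi> n\<close> is inverted on the formal sums supported in the basis, where it
  is injective. Restriction to the carrier matches the extensionality of arrows, so maps with the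
  same values on the carrier are equal functions.\<close>

definition transfer ::
  "(nat \<Rightarrow> 'b set) \<Rightarrow> 'u adcomplex \<Rightarrow> (nat \<Rightarrow> ('b \<Rightarrow>\<^sub>0 int) \<Rightarrow> 'u) \<Rightarrow> (nat \<Rightarrow> ('c \<Rightarrow>\<^sub>0 int) \<Rightarrow> 'v) \<Rightarrow>
   (nat \<Rightarrow> 'b \<Rightarrow> 'c \<Rightarrow>\<^sub>0 int) \<Rightarrow> nat \<Rightarrow> 'u \<Rightarrow> 'v" where
  "transfer B K \<phi> \<psi> f n =
     (\<lambda>a \<in> carrier (grp K n). \<psi> n (frag_extend (f n) (inv_into {x. ky x \<subseteq> B n} (\<phi> n) a)))"

context coordinates
begin

lemma transfer_phi:
  assumes "ky x \<subseteq> B n"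
  shows "transfer B K \<phi> \<psi> f n (\<phi> n x) = \<psi> n (frag_extend (f n) x)"
proof -
  have "inv_into {x. ky x \<subseteq> B n} (\<phi> n) (\<phi> n x) = x"
    using A.bij[of n] assms by (simp add: bij_betw_def)
  then show ?thesis
    using assms by (simp add: transfer_def)
qed

lemma transfer_eqI:
  assumes "\<And>n. h n \<in> extensional (carrier (grp K n))"
    and "\<And>n x. ky x \<subseteq> B n \<Longrightarrow> h n (\<phi> n x) = \<psi> n (frag_extend (f n) x)"
  shows "h = transfer B K \<phi> \<psi> f"
proof
  fix n
  show "h n = transfer B K \<phi> \<psi> f n"
  proof (rule extensionalityI[OF assms(1)])
    show "transfer B K \<phi> \<psi> f n \<in> extensional (carrier (grp K n))"
      by (simp add: transfer_def)
    show "h n a = transfer B K \<phi> \<psi> f n a" if "a \<in> carrier (grp K n)" for a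
      using that by (rule A.phi_cases) (simp add: transfer_phi assms(2))
  qed
qed

end

lemma transfer_frag_of: "coordinates B d K \<phi> \<Longrightarrow> transfer B K \<phi> \<phi> (\<lambda>n. frag_of) = (\<lambda>n. \<lambda>a \<in> carrier (grp K n). a)"
  by (rule coordinates.transfer_eqI[symmetric])
    (auto simp: frag_expansion[symmetric] free_pgroup.phi_closed[OF coordinates.free_pgroup])

locale coordinates_pair = K: coordinates B d K \<phi> + L: coordinates B' d' L \<psi>
  for B :: "nat \<Rightarrow> 'b set" and d and K :: "'u adcomplex" and \<phi> and B' :: "nat \<Rightarrow> 'b set" and d' and L :: "'u adcomplex" and \<psi>
begin

lemma transfer_adc_hom:
  assumes f: "chain_hom B d B' d' f"
  shows "transfer B K \<phi> \<psi> f \<in> adc_hom K L"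
proof -
  let ?h = "transfer B K \<phi> \<psi> f"
  note keys = chain_hom_keys[OF f]
  have "?h n \<in> hom (grp K n) (grp L n)" for n
  proof (rule homI)
    fix a b assume "a \<in> carrier (grp K n)" "b \<in> carrier (grp K n)"
    then obtain x y where *: "ky x \<subseteq> B n" "a = \<phi> n x" "ky y \<subseteq> B n" "b = \<phi> n y"
      by (metis K.A.phi_cases)
    moreover have "ky (x + y) \<subseteq> B n"
      using * keys_add[of x y] by blast
    ultimately show "?h n a \<in> carrier (grp L n)" "?h n (a \<otimes>\<^bsub>grp K n\<^esub> b) = ?h n a \<otimes>\<^bsub>grp L n\<^esub> ?h n b"
      by (simp_all add: K.transfer_phi keys frag_extend_add flip: K.A.phi_add L.A.phi_add)
  qed
  moreover have "?h n \<in> extensional (carrier (grp K n))" for n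
    by (simp add: transfer_def)
  moreover have "bd L n (?h (Suc n) a) = ?h n (bd K n a)" if "a \<in> carrier (grp K (Suc n))" for n a
    using that by (rule K.A.phi_cases)
      (simp add: K.transfer_phi K.bd_phi L.bd_phi K.keys_bd keys chain_hom_bd[OF f])
  moreover have "(?h n a, ?h n b) \<in> leq (grp L n)"
    if ab: "a \<in> carrier (grp K n)" "b \<in> carrier (grp K n)" "(a, b) \<in> leq (grp K n)" for n a b
  proof -
    obtain x y where *: "ky x \<subseteq> B n" "a = \<phi> n x" "ky y \<subseteq> B n" "b = \<phi> n y"
      using ab(1,2) by (metis K.A.phi_cases)
    moreover have "ky (y - x) \<subseteq> B n"
      using * keys_diff[of y x] by blast
    ultimately show ?thesis
      using ab(3) chain_hom_nonneg[OF f, of "y - x" n]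
      by (simp add: K.transfer_phi K.A.leq_phi L.A.leq_phi keys frag_extend_diff)
  qed
  moreover have "aug L (?h 0 a) = aug K a" if "a \<in> carrier (grp K 0)" for a
    using that by (rule K.A.phi_cases)
      (simp add: K.transfer_phi K.aug_phi L.aug_phi keys chain_hom_coeff_sum[OF f])
  ultimately show ?thesis
    unfolding adc_hom_def dcc_hom_def by blast
qed

lemma adc_hom_transfer:
  assumes "h \<in> adc_hom K L"
  obtains f where "chain_hom B d B' d' f" "h = transfer B K \<phi> \<psi> f"
proof -
  have hom: "h n \<in> hom (grp K n) (grp L n)" and ext: "h n \<in> extensional (carrier (grp K n))"
    and bd: "\<And>x. x \<in> carrier (grp K (Suc n)) \<Longrightarrow> bd L n (h (Suc n) x) = h n (bd K n x)"
    and mono: "\<And>a b. \<lbrakk>a \<in> carrier (grp K n); b \<in> carrier (grp K n); (a, b) \<in> leq (grp K n)\<rbrakk>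
      \<Longrightarrow> (h n a, h n b) \<in> leq (grp L n)" for n
    using assms unfolding adc_hom_def dcc_hom_def by auto
  have aug: "\<And>x. x \<in> carrier (grp K 0) \<Longrightarrow> aug L (h 0 x) = aug K x"
    using assms unfolding adc_hom_def by auto
  \<comment> \<open>The matrix of \<open>h\<close>: \<open>f n b\<close> holds the coordinates of
    the image of the basis element labelled \<open>b\<close>.\<close>
  define f where "f n b = inv_into {x. ky x \<subseteq> B' n} (\<psi> n) (h n (\<phi> n (frag_of b)))" for n b
  have f: "ky (f n b) \<subseteq> B' n" "\<psi> n (f n b) = h n (\<phi> n (frag_of b))" if "b \<in> B n" for n b
  proof -
    have *: "h n (\<phi> n (frag_of b)) \<in> \<psi> n ` {x. ky x \<subseteq> B' n}"
      using hom_in_carrier[OF hom K.A.phi_closed[of "frag_of b" n]] that unfolding L.A.carrier_eq by simp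
    show "ky (f n b) \<subseteq> B' n" "\<psi> n (f n b) = h n (\<phi> n (frag_of b))"
      using inv_into_into[OF *] f_inv_into_f[OF *] by (simp_all add: f_def)
  qed
  have keys: "ky (frag_extend (f n) x) \<subseteq> B' n" if "ky x \<subseteq> B n" for n x
    using that f(1) by (rule keys_frag_extend_subset)
  have h: "h n (\<phi> n x) = \<psi> n (frag_extend (f n) x)" if "ky x \<subseteq> B n" for n x
  proof (rule frag_hom_eq[OF _ _ L.A.is_group _ that])
    show "(\<lambda>x. h n (\<phi> n x)) \<in> hom (free_Abelian_group (B n)) (grp L n)"
      using Group.hom_compose[OF K.A.phi_hom hom] by (simp add: o_def)
    show "(\<lambda>x. \<psi> n (frag_extend (f n) x)) \<in> hom (free_Abelian_group (B n)) (grp L n)"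
      using Group.hom_compose[OF frag_extend_hom[OF f(1)] L.A.phi_hom] by (simp add: o_def)
  qed (simp add: f)
  have "chain_hom B d B' d' f"
    unfolding chain_hom_def
  proof (intro conjI allI ballI)
    show "ky (f n b) \<subseteq> B' n" if "b \<in> B n" for n b
      by (rule f(1)[OF that])
    show "nonneg (f n b)" if "b \<in> B n" for n b
    proof -
      \<comment> \<open>Nonnegative entries come from monotonicity applied to the inequality between
        0 and a basis element.\<close>
      have "(\<phi> n 0, \<phi> n (frag_of b)) \<in> leq (grp K n)"
        using that by (simp add: K.A.leq_phi)
      then have "(\<psi> n 0, \<psi> n (f n b)) \<in> leq (grp L n)"
        using mono[of "\<phi> n 0" n "\<phi> n (frag_of b)"] that h[of 0] f(2)[OF that] by simp
      then show ?thesis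
        using f(1)[OF that] by (simp add: L.A.leq_phi)
    qed
    show "coeff_sum (f 0 b) = 1" if "b \<in> B 0" for b
      using aug[of "\<phi> 0 (frag_of b)"] f[OF that] L.aug_phi[of "f 0 b"] K.aug_phi[of "frag_of b"] that by simp
    show "frag_extend (d' n) (f (Suc n) b) = frag_extend (f n) (d n b)" if b: "b \<in> B (Suc n)" for n b
    proof -
      have "bd K n (\<phi> (Suc n) (frag_of b)) = \<phi> n (d n b)"
        using b by (simp add: K.bd_phi)
      then have "bd L n (\<psi> (Suc n) (f (Suc n) b)) = h n (\<phi> n (d n b))"
        using bd[of "\<phi> (Suc n) (frag_of b)" n] f(2)[OF b] b by simp
      then show ?thesis
        using f(1)[OF b] K.keys_d[OF b] by (simp add: L.bd_phi h L.A.phi_eq_iff L.keys_bd keys)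
    qed
  qed
  then show thesis
    using that K.transfer_eqI[OF ext h] by blast
qed

text \<open>Matrices may differ outside the basis without affecting the map, so the comparison is
  restricted to basis elements.\<close>

lemma transfer_eq_iff:
  assumes "chain_hom B d B' d' f" "chain_hom B d B' d' g"
  shows "transfer B K \<phi> \<psi> f = transfer B K \<phi> \<psi> g \<longleftrightarrow> (\<forall>n. \<forall>b \<in> B n. f n b = g n b)"
proof
  assume *: "transfer B K \<phi> \<psi> f = transfer B K \<phi> \<psi> g"
  show "\<forall>n. \<forall>b \<in> B n. f n b = g n b"
  proof (intro allI ballI)
    fix n b assume b: "b \<in> B n"
    have "\<psi> n (f n b) = \<psi> n (g n b)"
      using fun_cong[OF fun_cong[OF *, of n], of "\<phi> n (frag_of b)"] b by (simp add: K.transfer_phi)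
    then show "f n b = g n b"
      using assms b unfolding chain_hom_def by (simp add: L.A.phi_eq_iff)
  qed
next
  assume *: "\<forall>n. \<forall>b \<in> B n. f n b = g n b"
  show "transfer B K \<phi> \<psi> f = transfer B K \<phi> \<psi> g"
  proof (rule K.transfer_eqI)
    fix n and x :: "'b \<Rightarrow>\<^sub>0 int" assume x: "ky x \<subseteq> B n"
    then have "frag_extend (f n) x = frag_extend (g n) x"
      using * by (intro frag_extend_eq) blast
    then show "transfer B K \<phi> \<psi> f n (\<phi> n x) = \<psi> n (frag_extend (g n) x)"
      using x by (simp add: K.transfer_phi)
  qed (simp add: transfer_def)
qed

lemma transfer_comp:
  assumes f: "chain_hom B d B' d' f"
  shows "(\<lambda>n. compose (carrier (grp K n)) (transfer B' L \<psi> \<chi> g n) (transfer B K \<phi> \<psi> f n)) =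
    transfer B K \<phi> \<chi> (\<lambda>n b. frag_extend (g n) (f n b))"
  by (rule K.transfer_eqI)
    (simp_all add: compose_def K.transfer_phi L.transfer_phi chain_hom_keys[OF f] frag_extend_extend)

end

section \<open>The category of weak Steiner complexes\<close>

lemma adc_hom_undefined: "\<lbrakk>f \<in> adc_hom K L; a \<notin> carrier (grp K n)\<rbrakk> \<Longrightarrow> f n a = undefined"
  unfolding adc_hom_def dcc_hom_def extensional_def by auto

lemma adc_hom_closed: "\<lbrakk>f \<in> adc_hom K L; a \<in> carrier (grp K n)\<rbrakk> \<Longrightarrow> f n a \<in> carrier (grp L n)"
  unfolding adc_hom_def dcc_hom_def hom_def by auto

lemma bd_closed: "\<lbrakk>augmented_directed_complex K; a \<in> carrier (grp K (Suc n))\<rbrakk> \<Longrightarrow> bd K n a \<in> carrier (grp K n)"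
  unfolding augmented_directed_complex_def directed_chain_complex_def hom_def by auto

lemma mult_closed: "\<lbrakk>augmented_directed_complex K; a \<in> carrier (grp K n); b \<in> carrier (grp K n)\<rbrakk>
  \<Longrightarrow> a \<otimes>\<^bsub>grp K n\<^esub> b \<in> carrier (grp K n)"
  unfolding augmented_directed_complex_def directed_chain_complex_def preordered_abelian_group_def
    comm_group_def comm_monoid_def by (auto intro: monoid.m_closed)

lemma is_category_WSC: "is_category WSC"
  unfolding is_category_def WSC_def full_subcategory_def ADC_def
proof (simp, intro conjI allI ballI impI, goal_cases)
  case (1 K)
  then show ?case
    by (auto simp: adc_hom_def dcc_hom_def hom_def bd_closed mult_closed)
next
  case (2 K L M f g)
  then show ?case
    using adc_hom_closed[OF 2(4)] adc_hom_closed[OF 2(5)] unfolding adc_hom_def dcc_hom_def hom_def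
    by (auto simp: compose_def bd_closed mult_closed)
next
  case (3 K L f)
  then show ?case
    by (intro ext) (auto simp: compose_def adc_hom_undefined)
next
  case (4 K L f)
  then show ?case
    by (intro ext) (auto simp: compose_def adc_hom_undefined adc_hom_closed)
next
  case (5 K L M N f g h)
  then show ?case
    by (intro ext) (auto simp: compose_def adc_hom_closed)
qed

section \<open>The linearization functor\<close>

text \<open>Groups have their elements in \<open>'u\<close>, so the free groups are transported along an injection
  \<open>e\<close> of the formal sums over \<open>'u\<close> into \<open>'u\<close>.\<close>

definition free_adc ::
  "(('b \<Rightarrow>\<^sub>0 int) \<Rightarrow> 'u) \<Rightarrow> (nat \<Rightarrow> 'b set) \<Rightarrow> (nat \<Rightarrow> 'b \<Rightarrow> 'b \<Rightarrow>\<^sub>0 int) \<Rightarrow> 'u adcomplex" where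
  "free_adc e B d =
    \<lparr>grp = \<lambda>n. \<lparr>carrier = e ` {x. ky x \<subseteq> B n}, monoid.mult = \<lambda>a b. e (inv_into UNIV e a + inv_into UNIV e b), one = e 0,
       leq = {(e x, e y) | x y. ky x \<subseteq> B n \<and> ky y \<subseteq> B n \<and> nonneg (y - x)}\<rparr>,
     bd = \<lambda>n a. e (frag_extend (d n) (inv_into UNIV e a)),
     aug = \<lambda>a. coeff_sum (inv_into UNIV e a)\<rparr>"

lemma coordinates_free_adc:
  assumes "free_complex B d" and e: "inj e"
  shows "coordinates B d (free_adc e B d) (\<lambda>n. e)"
proof -
  interpret free_complex B d by fact
  have iso: "e \<in> iso (free_Abelian_group (B n)) (grp (free_adc e B d) n)" for n
    using inj_on_subset[OF e subset_UNIV]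
    by (auto simp: iso_def hom_def bij_betw_def free_adc_def inv_f_f[OF e] dest: subsetD[OF keys_add])
  have comm: "comm_group (grp (free_adc e B d) n)" for n
    using comm_group.iso_imp_img_comm_group[OF abelian_free_Abelian_group iso[of n]]
    by (simp add: free_adc_def)
  have "free_pgroup (grp (free_adc e B d) n) (B n) e" for n
    by (rule free_pgroup.intro[OF comm iso]) (simp add: free_adc_def)
  then show ?thesis
    by (intro coordinates.intro free_complex_axioms coordinates_axioms.intro)
      (simp_all add: free_adc_def inv_f_f[OF e])
qed

definition linearization :: "(('u \<Rightarrow>\<^sub>0 int) \<Rightarrow> 'u) \<Rightarrow>
  ('u parity, nat \<Rightarrow> 'u \<Rightarrow> 'u set, 'u adcomplex, nat \<Rightarrow> 'u \<Rightarrow> 'u) cat_functor" where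
  "linearization e =
    \<lparr>fob = \<lambda>C. free_adc e (cells C) (boundary C),
     far = \<lambda>C D f. transfer (cells C) (free_adc e (cells C) (boundary C)) (\<lambda>n. e) (\<lambda>n. e) (\<lambda>n x. ind (f n x))\<rparr>"

lemma coordinates_linearization:
  assumes "inj e" "weak_parity_complex C"
  shows "coordinates (cells C) (boundary C) (free_adc e (cells C) (boundary C)) (\<lambda>n. e)"
  using coordinates_free_adc[OF _ assms(1)] weak_parity_complex_imp_steiner[OF assms(2)]
  unfolding steiner_def by blast

lemma is_functor_linearization:
  assumes e: "inj e"
  shows "is_functor WPC WSC (linearization e)"
  unfolding is_functor_def
proof (intro conjI ballI)
  note co = coordinates_linearization[OF e]
  note pair = coordinates_pair.intro[OF co co]
  fix C :: "'a parity" assume "C \<in> obj WPC"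
  then have C: "weak_parity_complex C"
    by (simp add: WPC_def)
  interpret C: steiner "cells C" "boundary C"
    using C by (rule weak_parity_complex_imp_steiner)
  show "fob (linearization e) C \<in> obj WSC"
    using coordinates.augmented_directed_complex[OF co[OF C]]
      coordinates.weak_steiner_complex_if_steiner[OF co[OF C] C.steiner_axioms]
    by (simp add: linearization_def WSC_def full_subcategory_def ADC_def)
  have "far (linearization e) C C (idn WPC C)
      = transfer (cells C) (free_adc e (cells C) (boundary C)) (\<lambda>n. e) (\<lambda>n. e) (\<lambda>n. frag_of)"
  proof -
    have "chain_hom (cells C) (boundary C) (cells C) (boundary C) (\<lambda>n x. ind (idn WPC C n x))"
      by (subst chain_hom_cong[OF C.free_complex_axioms, of _ "\<lambda>n. frag_of"])
        (simp_all add: WPC_def chain_hom_frag_of)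
    then show ?thesis
      using coordinates_pair.transfer_eq_iff[OF pair[OF C C] _ chain_hom_frag_of]
      by (simp add: linearization_def) (simp add: WPC_def)
  qed
  then show "far (linearization e) C C (idn WPC C) = idn WSC (fob (linearization e) C)"
    using transfer_frag_of[OF co[OF C]]
    by (simp add: linearization_def WSC_def full_subcategory_def ADC_def)
  fix D :: "'a parity" assume "D \<in> obj WPC"
  then have D: "weak_parity_complex D"
    by (simp add: WPC_def)
  fix f assume "f \<in> arr WPC C D"
  then have f: "f \<in> wpc_hom C D" "chain_hom (cells C) (boundary C) (cells D) (boundary D) (\<lambda>n x. ind (f n x))"
    using wpc_hom_iff[OF C D] by (auto simp: WPC_def)
  show "far (linearization e) C D f \<in> arr WSC (fob (linearization e) C) (fob (linearization e) D)"
    using coordinates_pair.transfer_adc_hom[OF pair[OF C D] f(2)]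
    by (simp add: linearization_def WSC_def full_subcategory_def ADC_def)
  fix E :: "'a parity" assume "E \<in> obj WPC"
  then have E: "weak_parity_complex E"
    by (simp add: WPC_def)
  interpret D: steiner "cells D" "boundary D"
    using D by (rule weak_parity_complex_imp_steiner)
  fix g assume "g \<in> arr WPC D E"
  then have g: "g \<in> wpc_hom D E" "chain_hom (cells D) (boundary D) (cells E) (boundary E) (\<lambda>n x. ind (g n x))"
    using wpc_hom_iff[OF D E] by (auto simp: WPC_def)
  let ?gf = "cmp WPC C D E g f"
  have "?gf \<in> wpc_hom C E"
    using wpc_hom_comp[OF C D E f(1) g(1)] by (simp add: WPC_def)
  then have gf: "chain_hom (cells C) (boundary C) (cells E) (boundary E) (\<lambda>n x. ind (?gf n x))"
    using wpc_hom_iff[OF C E] by blast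
  have "far (linearization e) C E ?gf = transfer (cells C) (free_adc e (cells C) (boundary C)) (\<lambda>n. e) (\<lambda>n. e)
      (\<lambda>n x. frag_extend (\<lambda>y. ind (g n y)) (ind (f n x)))"
    using coordinates_pair.transfer_eq_iff[OF pair[OF C E] gf chain_hom_comp[OF f(2) g(2) C.free_complex_axioms]]
      ind_Union_wpc_hom[OF C D E f(1) g(1)]
    by (simp add: linearization_def) (simp add: WPC_def)
  then show "far (linearization e) C E ?gf =
      cmp WSC (fob (linearization e) C) (fob (linearization e) D) (fob (linearization e) E)
        (far (linearization e) D E g) (far (linearization e) C D f)"
    using coordinates_pair.transfer_comp[OF pair[OF C D] f(2), where \<chi> = "\<lambda>n. e" and g = "\<lambda>n x. ind (g n x)"]
    by (simp add: linearization_def WSC_def full_subcategory_def ADC_def)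
qed

lemma bij_betw_linearization:
  assumes e: "inj e" and C: "weak_parity_complex C" and D: "weak_parity_complex D"
  shows "bij_betw (far (linearization e) C D) (wpc_hom C D)
    (adc_hom (fob (linearization e) C) (fob (linearization e) D))"
proof -
  interpret C: steiner "cells C" "boundary C"
    using C by (rule weak_parity_complex_imp_steiner)
  interpret D: steiner "cells D" "boundary D"
    using D by (rule weak_parity_complex_imp_steiner)
  interpret coordinates_pair "cells C" "boundary C" "free_adc e (cells C) (boundary C)" "\<lambda>n. e"
      "cells D" "boundary D" "free_adc e (cells D) (boundary D)" "\<lambda>n. e"
    by (intro coordinates_pair.intro coordinates_linearization e C D)
  have chain: "chain_hom (cells C) (boundary C) (cells D) (boundary D) (\<lambda>n x. ind (f n x))" if "f \<in> wpc_hom C D" for f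
    using that wpc_hom_iff[OF C D] by blast
  show ?thesis
    unfolding bij_betw_def
  proof (intro conjI equalityI subsetI)
    show "inj_on (far (linearization e) C D) (wpc_hom C D)"
    proof (rule inj_onI)
      fix f g assume f: "f \<in> wpc_hom C D" and g: "g \<in> wpc_hom C D"
        and "far (linearization e) C D f = far (linearization e) C D g"
      then have "\<forall>n. \<forall>x \<in> cells C n. ind (f n x) = ind (g n x)"
        using transfer_eq_iff[OF chain[OF f] chain[OF g]] by (simp add: linearization_def)
      then have "f n x = g n x" if "x \<in> cells C n" for n x
        using that wpc_hom_cells[OF f that] wpc_hom_cells[OF g that] keys_ind by metis
      then have "f n x = g n x" for n x
        using wpc_hom_undefined[OF f] wpc_hom_undefined[OF g] by (cases "x \<in> cells C n") auto
      then show "f = g"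
        by blast
    qed
    show "h \<in> adc_hom (fob (linearization e) C) (fob (linearization e) D)"
      if "h \<in> far (linearization e) C D ` wpc_hom C D" for h
      using that transfer_adc_hom[OF chain] by (auto simp: linearization_def)
    fix h assume "h \<in> adc_hom (fob (linearization e) C) (fob (linearization e) D)"
    then obtain f where f: "chain_hom (cells C) (boundary C) (cells D) (boundary D) f"
      and h: "h = transfer (cells C) (free_adc e (cells C) (boundary C)) (\<lambda>n. e) (\<lambda>n. e) f"
      using adc_hom_transfer by (auto simp: linearization_def)
    \<comment> \<open>Fullness: supports suffice to recover \<open>f\<close>, since the image of a
      cell is good and so is the indicator of its support.\<close>
    define g where "g n = (\<lambda>x \<in> cells C n. ky (f n x))" for n
    have ind_g: "ind (g n x) = f n x" if "x \<in> cells C n" for n x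
      using D.good_ind[OF chain_hom_good[OF f C.free_complex_axioms C.good_frag_of[OF that]]] that
      by (simp add: g_def)
    have g: "chain_hom (cells C) (boundary C) (cells D) (boundary D) (\<lambda>n x. ind (g n x))"
      by (subst chain_hom_cong[OF C.free_complex_axioms, of _ f]) (simp_all add: ind_g f)
    have "g n \<in> cells C n \<rightarrow>\<^sub>E Fpow (cells D n)" for n
      using f unfolding chain_hom_def g_def Fpow_def by auto
    then have "g \<in> wpc_hom C D"
      using g wpc_hom_iff[OF C D] by blast
    moreover have "far (linearization e) C D g = h"
      using transfer_eq_iff[OF g f] ind_g by (simp add: linearization_def h)
    ultimately show "h \<in> far (linearization e) C D ` wpc_hom C D"
      by blast
  qed
qed

lemma isomorphism_linearization:
  assumes e: "inj (e :: ('u \<Rightarrow>\<^sub>0 int) \<Rightarrow> 'u)" and K: "weak_steiner_complex K"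
  obtains C h where "weak_parity_complex C" "isomorphism WSC (fob (linearization e) C) K h"
proof -
  obtain B :: "nat \<Rightarrow> 'u set" and d \<phi> where "steiner B d" and "coordinates B d K \<phi>"
    using K by (rule weak_steiner_complex_coordinates)
  then interpret steiner B d + K: coordinates B d K \<phi>
    by simp_all
  let ?C = "parity_of B d"
  have C: "weak_parity_complex ?C"
    by (rule weak_parity_complex_parity_of)
  have cells: "cells ?C = B"
    by (simp add: parity_of_def)
  \<comment> \<open>\<open>boundary ?C\<close> agrees with \<open>d\<close> on the basis, so
    \<open>K\<close> and the free complex \<open>?L\<close> are described by the same labels and the
    same boundary.\<close>
  have K: "coordinates B (boundary ?C) K \<phi>"
  proof -
    have "frag_extend (boundary ?C n) x = frag_extend (d n) x" if "ky x \<subseteq> B (Suc n)" for n x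
      using that boundary_parity_of by (intro frag_extend_eq) blast
    then show ?thesis
      using steiner_parity_of K.coordinates_axioms
      unfolding steiner_def coordinates_def coordinates_axioms_def by simp
  qed
  let ?L = "free_adc e B (boundary ?C)"
  have L: "coordinates B (boundary ?C) ?L (\<lambda>n. e)"
    using coordinates_linearization[OF e C] by (simp add: cells)
  interpret KL: coordinates_pair B "boundary ?C" K \<phi> B "boundary ?C" ?L "\<lambda>n. e"
    using K L by (rule coordinates_pair.intro)
  interpret LK: coordinates_pair B "boundary ?C" ?L "\<lambda>n. e" B "boundary ?C" K \<phi>
    using L K by (rule coordinates_pair.intro)
  \<comment> \<open>With common coordinates the identity matrix is a chain map in both directions,
    and its two transfers compose to identities.\<close>
  have "isomorphism WSC ?L K (transfer B ?L (\<lambda>n. e) \<phi> (\<lambda>n. frag_of))"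
    unfolding isomorphism_def
  proof (intro conjI bexI[of _ "transfer B K \<phi> (\<lambda>n. e) (\<lambda>n. frag_of)"])
  qed (use KL.transfer_adc_hom[OF chain_hom_frag_of] LK.transfer_adc_hom[OF chain_hom_frag_of]
      KL.transfer_comp[OF chain_hom_frag_of, of \<phi> "\<lambda>n. frag_of"]
      LK.transfer_comp[OF chain_hom_frag_of, of "\<lambda>n. e" "\<lambda>n. frag_of"]
      transfer_frag_of[OF K] transfer_frag_of[OF L]
    in \<open>simp_all add: WSC_def full_subcategory_def ADC_def\<close>)
  then show thesis
    using that C by (simp add: linearization_def cells)
qed

theorem theorem4p28:
  assumes "infinite (UNIV :: 'u set)"
  shows "equivalent_categories
    (WPC :: ('u parity, nat \<Rightarrow> 'u \<Rightarrow> 'u set) category)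
    (WSC :: ('u adcomplex, nat \<Rightarrow> 'u \<Rightarrow> 'u) category)"
proof -
  \<comment> \<open>The free abelian group on an infinite set is equipotent to that set; this yields
    the encoding \<open>e\<close> of formal sums by elements of \<open>'u\<close>.\<close>
  have "(UNIV :: ('u \<Rightarrow>\<^sub>0 int) set) \<lesssim> (UNIV :: 'u set)"
  proof -
    have "carrier (free_Abelian_group (UNIV :: 'u set)) = UNIV"
      by auto
    then show ?thesis
      using eqpoll_imp_lepoll[OF eqpoll_free_Abelian_group_infinite[OF assms]] by simp
  qed
  then obtain e :: "('u \<Rightarrow>\<^sub>0 int) \<Rightarrow> 'u" where e: "inj e"
    unfolding lepoll_def by blast
  show ?thesis
  proof (rule equivalent_categories_if_fully_faithful_surjective[of _ _ "linearization e"])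
    show "bij_betw (far (linearization e) X Y) (arr WPC X Y)
        (arr WSC (fob (linearization e) X) (fob (linearization e) Y))"
      if "X \<in> obj WPC" "Y \<in> obj WPC" for X Y
      using bij_betw_linearization[OF e] that by (simp add: WPC_def WSC_def full_subcategory_def ADC_def)
    show "\<exists>X \<in> obj WPC. \<exists>h. isomorphism WSC (fob (linearization e) X) Y h" if "Y \<in> obj WSC" for Y
    proof -
      have "weak_steiner_complex Y"
        using that by (simp add: WSC_def full_subcategory_def)
      then obtain C h where "weak_parity_complex C" "isomorphism WSC (fob (linearization e) C) Y h"
        using isomorphism_linearization[OF e] by blast
      then show ?thesis
        by (auto simp: WPC_def)
    qed
  qed (rule is_category_WPC is_category_WSC is_functor_linearization[OF e])+
qed

end
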